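(* We have the reproducing kernel expansion $$\frac{Z-W}{N(Z-W)}=-\sum_{l\ge0;\,m,n}\frac1{2l+1}f^{(1)}_{l,m,n}(Z)\cdot\tilde g^{(1)}_{l,m,n}(W)+\sum_{l\ge1/2;\,m,n}\frac1{2l(2l+1)}f^{(2)}_{l,m,n}(Z)\cdot\tilde g^{(2)}_{l,m,n}(W)+\sum_{l\ge1;\,m,n}\frac1{2l}f^{(3)}_{l,m,n}(Z)\cdot\tilde g^{(3)}_{l,m,n}(W),$$ which converges uniformly on compact subsets in the region $\{(Z,W)\in\mathbb H_{\mathbb C}\times\mathbb H_{\mathbb C}^\times;\ ZW^{-1}\in\mathbb D^+\}$; the sum is taken first over all applicable $m$ and $n$, then over $l=0,\frac12,1,\frac32,\dots$. Similarly, $$\frac{Z-W}{N(Z-W)}=\sum_{l\ge0;\,m,n}\frac1{2l+1}\tilde f^{(1)}_{l,m,n}(Z)\cdot g^{(1)}_{l,m,n}(W)-\sum_{l\ge1/2;\,m,n}\frac1{2l(2l+1)}\tilde f^{(2)}_{l,m,n}(Z)\cdot g^{(2)}_{l,m,n}(W)-\sum_{l\ge1;\,m,n}\frac1{2l}\tilde f^{(3)}_{l,m,n}(Z)\cdot g^{(3)}_{l,m,n}(W),$$ which converges uniformly on compact subsets in the region $\{(Z,W)\in\mathbb H_{\mathbb C}^\times\times\mathbb H_{\mathbb C};\ Z^{-1}W\in\mathbb D^+\}$; the sum is taken first over all applicable $m$ and $n$, then over $l=0,\frac12,1,\frac32,\dots$.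
   Context: $\mathbb H_{\mathbb C}$ is identified with the algebra of $2\times2$ complex matrices $Z=\bigl(\begin{smallmatrix}z_{11}&z_{12}\\ z_{21}&z_{22}\end{smallmatrix}\bigr)$; $N(Z)=\det Z$; $\mathbb H_{\mathbb C}^\times$ is the set of invertible elements; $\mathbb D^+=\{Z;ZZ^*<1\}$ ($ZZ^*-1$ negative definite). For a column $f$ and a row $g$, $f\cdot g$ is a $2\times2$ matrix. $t^l_{n\,\underline m}(Z)=\frac1{2\pi i}\oint(sz_{11}+z_{21})^{l-m}(sz_{12}+z_{22})^{l+m}s^{-l+n}\frac{ds}s$ for $l=0,\frac12,1,\dots$, $m,n\in\mathbb Z+l$, $-l\le m,n\le l$ (counterclockwise loop around $0$), and $t^l_{n\,\underline m}=0$ for out-of-range indices. For $l=0,\frac12,1,\dots$ (indices advance in steps of $1$ from the lower to the upper bound): $f^{(1)}_{l,m,n}(Z)=\Bigl(\begin{smallmatrix}t^l_{n-1/2\,\underline m}(Z)\\-t^l_{n+1/2\,\underline m}(Z)\end{smallmatrix}\Bigr)$ and $\tilde g^{(1)}_{l,m,n}(Z)=\bigl((l+m+1)t^{l+1/2}_{m+1/2\,\underline n}(Z^{-1}),-(l-m+1)t^{l+1/2}_{m-1/2\,\underline n}(Z^{-1})\bigr)$, $|m|\le l$, $|n|\le l+\frac12$; $f^{(2)}_{l,m,n}(Z)=\Bigl(\begin{smallmatrix}(l-n+1/2)t^l_{n-1/2\,\underline m}(Z)\\(l+n+1/2)t^l_{n+1/2\,\underline m}(Z)\end{smallmatrix}\Bigr)$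 and $\tilde g^{(2)}_{l,m,n}(Z)=N(Z)^{-1}\bigl(t^{l-1/2}_{m+1/2\,\underline n}(Z^{-1}),t^{l-1/2}_{m-1/2\,\underline n}(Z^{-1})\bigr)$, $|m|\le l$, $|n|\le l-\frac12$; $f^{(3)}_{l,m,n}(Z)=N(Z)\Bigl(\begin{smallmatrix}t^{l-1}_{n-1/2\,\underline m}(Z)\\-t^{l-1}_{n+1/2\,\underline m}(Z)\end{smallmatrix}\Bigr)$ and $\tilde g^{(3)}_{l,m,n}(Z)=N(Z)^{-1}\bigl((l+m)t^{l-1/2}_{m+1/2\,\underline n}(Z^{-1}),-(l-m)t^{l-1/2}_{m-1/2\,\underline n}(Z^{-1})\bigr)$, $|m|\le l-1$, $|n|\le l-\frac12$; $\tilde f^{(1)}_{l,m,n}(Z)=\Bigl(\begin{smallmatrix}t^{l+1/2}_{m\,\underline{n+1/2}}(Z^{-1})\\-t^{l+1/2}_{m\,\underline{n-1/2}}(Z^{-1})\end{smallmatrix}\Bigr)$ and $g^{(1)}_{l,m,n}(Z)=\bigl((l+m+\frac12)t^l_{n\,\underline{m-1/2}}(Z),-(l-m+\frac12)t^l_{n\,\underline{m+1/2}}(Z)\bigr)$, $|m|\le l+\frac12$, $|n|\le l$; $\tilde f^{(2)}_{l,m,n}(Z)=N(Z)^{-1}\Bigl(\begin{smallmatrix}(l-n)t^{l-1/2}_{m\,\underline{n+1/2}}(Z^{-1})\\(l+n)t^{l-1/2}_{m\,\underline{n-1/2}}(Z^{-1})\end{smallmatrix}\Bigr)$ and $g^{(2)}_{l,m,n}(Z)=\bigl(t^l_{n\,\underline{m-1/2}}(Z),t^l_{n\,\underline{m+1/2}}(Z)\bigr)$,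 $|m|\le l-\frac12$, $|n|\le l$; $\tilde f^{(3)}_{l,m,n}(Z)=N(Z)^{-1}\Bigl(\begin{smallmatrix}t^{l-1/2}_{m\,\underline{n+1/2}}(Z^{-1})\\-t^{l-1/2}_{m\,\underline{n-1/2}}(Z^{-1})\end{smallmatrix}\Bigr)$ and $g^{(3)}_{l,m,n}(Z)=N(Z)\bigl((l+m-\frac12)t^{l-1}_{n\,\underline{m-1/2}}(Z),-(l-m-\frac12)t^{l-1}_{n\,\underline{m+1/2}}(Z)\bigr)$, $|m|\le l-\frac12$, $|n|\le l-1$. *)

theory Defs
  imports "HOL-Analysis.Analysis" "HOL-Complex_Analysis.Contour_Integration"
begin

text \<open>The complexified quaternions are the type \<^typ>\<open>complex^2^2\<close>; the norm \<open>N(Z)\<close> is \<^term>\<open>det Z\<close>.\<close>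

definition adjoint_mat :: "complex^2^2 \<Rightarrow> complex^2^2"
  where "adjoint_mat Z = (\<chi> i j. cnj (Z $ j $ i))"

definition negative_definite :: "complex^2^2 \<Rightarrow> bool"
  where "negative_definite A \<longleftrightarrow> adjoint_mat A = A \<and>
    (\<forall>x::complex^2. x \<noteq> 0 \<longrightarrow> Re (\<Sum>i\<in>UNIV. \<Sum>j\<in>UNIV. cnj (x $ i) * A $ i $ j * x $ j) < 0)"

definition Dplus :: "(complex^2^2) set"
  where "Dplus = {Z. negative_definite (Z ** adjoint_mat Z - mat 1)}"

definition column_times_row :: "complex^2 \<Rightarrow> complex^2 \<Rightarrow> complex^2^2" (infixl \<open>\<odot>\<close> 70)
  where "f \<odot> g = (\<chi> i j. f $ i * g $ j)"

definition repr_kernel :: "(complex^2^2) \<times> (complex^2^2) \<Rightarrow> complex^2^2"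
  where "repr_kernel = (\<lambda>(Z, W). \<chi> i j. (Z - W) $ i $ j / det (Z - W))"

definition region :: "((complex^2^2) \<times> (complex^2^2)) set"
  where "region = {(Z, W). invertible W \<and> Z ** matrix_inv W \<in> Dplus}"

definition region' :: "((complex^2^2) \<times> (complex^2^2)) set"
  where "region' = {(Z, W). invertible Z \<and> matrix_inv Z ** W \<in> Dplus}"


text \<open>
  The parameters \<open>l, m, n\<close> are integers or half-integers, represented as reals.
  For \<open>b\<close> in \<open>{0, 1/2, 1, \<dots>}\<close>, \<open>idx b\<close> is \<open>{-b, -b + 1, \<dots>, b}\<close>; it is empty for \<open>b < 0\<close>.
\<close>

definition idx :: "real \<Rightarrow> real set"
  where "idx b = {m. m - b \<in> \<int> \<and> - b \<le> m \<and> m \<le> b}"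

text \<open>
  The argument order is \<open>t l n m Z\<close>, where \<open>m\<close> is the underlined index. The integrand is
  holomorphic off 0, so the unit circle stands for any counterclockwise loop around 0.
  In the first branch \<open>l - m\<close>, \<open>l + m\<close>, \<open>n - l\<close> are integers, and
  the first two are nonnegative, so the floors and \<open>nat\<close> only change the type.
\<close>

definition t :: "real \<Rightarrow> real \<Rightarrow> real \<Rightarrow> complex^2^2 \<Rightarrow> complex"
  where "t l n m Z =
    (if m \<in> idx l \<and> n \<in> idx l
     then 1 / (2 * of_real pi * \<i>) * contour_integral (circlepath 0 1)
       (\<lambda>s. (s * Z$1$1 + Z$2$1) ^ nat \<lfloor>l - m\<rfloor> * (s * Z$1$2 + Z$2$2) ^ nat \<lfloor>l + m\<rfloor>
            * s powi \<lfloor>- l + n\<rfloor> / s)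
     else 0)"

text \<open>The suffix \<open>t\<close> in \<open>ft1\<close>, \<open>gt1\<close>, \<dots> stands for the tilde.\<close>

definition f1 :: "real \<Rightarrow> real \<Rightarrow> real \<Rightarrow> complex^2^2 \<Rightarrow> complex^2"
  where "f1 l m n Z = vector [t l (n - 1/2) m Z, - t l (n + 1/2) m Z]"

definition gt1 :: "real \<Rightarrow> real \<Rightarrow> real \<Rightarrow> complex^2^2 \<Rightarrow> complex^2"
  where "gt1 l m n Z = vector
    [of_real (l + m + 1) * t (l + 1/2) (m + 1/2) n (matrix_inv Z),
     - of_real (l - m + 1) * t (l + 1/2) (m - 1/2) n (matrix_inv Z)]"

definition f2 :: "real \<Rightarrow> real \<Rightarrow> real \<Rightarrow> complex^2^2 \<Rightarrow> complex^2"
  where "f2 l m n Z = vector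
    [of_real (l - n + 1/2) * t l (n - 1/2) m Z,
     of_real (l + n + 1/2) * t l (n + 1/2) m Z]"

definition gt2 :: "real \<Rightarrow> real \<Rightarrow> real \<Rightarrow> complex^2^2 \<Rightarrow> complex^2"
  where "gt2 l m n Z = inverse (det Z) *s vector
    [t (l - 1/2) (m + 1/2) n (matrix_inv Z), t (l - 1/2) (m - 1/2) n (matrix_inv Z)]"

definition f3 :: "real \<Rightarrow> real \<Rightarrow> real \<Rightarrow> complex^2^2 \<Rightarrow> complex^2"
  where "f3 l m n Z = det Z *s vector [t (l - 1) (n - 1/2) m Z, - t (l - 1) (n + 1/2) m Z]"

definition gt3 :: "real \<Rightarrow> real \<Rightarrow> real \<Rightarrow> complex^2^2 \<Rightarrow> complex^2"
  where "gt3 l m n Z = inverse (det Z) *s vector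
    [of_real (l + m) * t (l - 1/2) (m + 1/2) n (matrix_inv Z),
     - of_real (l - m) * t (l - 1/2) (m - 1/2) n (matrix_inv Z)]"

definition ft1 :: "real \<Rightarrow> real \<Rightarrow> real \<Rightarrow> complex^2^2 \<Rightarrow> complex^2"
  where "ft1 l m n Z = vector
    [t (l + 1/2) m (n + 1/2) (matrix_inv Z), - t (l + 1/2) m (n - 1/2) (matrix_inv Z)]"

definition g1 :: "real \<Rightarrow> real \<Rightarrow> real \<Rightarrow> complex^2^2 \<Rightarrow> complex^2"
  where "g1 l m n Z = vector
    [of_real (l + m + 1/2) * t l n (m - 1/2) Z,
     - of_real (l - m + 1/2) * t l n (m + 1/2) Z]"

definition ft2 :: "real \<Rightarrow> real \<Rightarrow> real \<Rightarrow> complex^2^2 \<Rightarrow> complex^2"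
  where "ft2 l m n Z = inverse (det Z) *s vector
    [of_real (l - n) * t (l - 1/2) m (n + 1/2) (matrix_inv Z),
     of_real (l + n) * t (l - 1/2) m (n - 1/2) (matrix_inv Z)]"

definition g2 :: "real \<Rightarrow> real \<Rightarrow> real \<Rightarrow> complex^2^2 \<Rightarrow> complex^2"
  where "g2 l m n Z = vector [t l n (m - 1/2) Z, t l n (m + 1/2) Z]"

definition ft3 :: "real \<Rightarrow> real \<Rightarrow> real \<Rightarrow> complex^2^2 \<Rightarrow> complex^2"
  where "ft3 l m n Z = inverse (det Z) *s vector
    [t (l - 1/2) m (n + 1/2) (matrix_inv Z), - t (l - 1/2) m (n - 1/2) (matrix_inv Z)]"

definition g3 :: "real \<Rightarrow> real \<Rightarrow> real \<Rightarrow> complex^2^2 \<Rightarrow> complex^2"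
  where "g3 l m n Z = det Z *s vector
    [of_real (l + m - 1/2) * t (l - 1) n (m - 1/2) Z,
     - of_real (l - m - 1/2) * t (l - 1) n (m + 1/2) Z]"


text \<open>For fixed \<open>l\<close>, the finite sums over \<open>m\<close> and \<open>n\<close> in the two expansions, without their signs.\<close>

definition A1 :: "real \<Rightarrow> (complex^2^2) \<times> (complex^2^2) \<Rightarrow> complex^2^2"
  where "A1 l = (\<lambda>(Z, W). \<Sum>m\<in>idx l. \<Sum>n\<in>idx (l + 1/2).
    (1 / (2 * l + 1)) *\<^sub>R (f1 l m n Z \<odot> gt1 l m n W))"

definition A2 :: "real \<Rightarrow> (complex^2^2) \<times> (complex^2^2) \<Rightarrow> complex^2^2"
  where "A2 l = (\<lambda>(Z, W). \<Sum>m\<in>idx l. \<Sum>n\<in>idx (l - 1/2).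
    (1 / (2 * l * (2 * l + 1))) *\<^sub>R (f2 l m n Z \<odot> gt2 l m n W))"

definition A3 :: "real \<Rightarrow> (complex^2^2) \<times> (complex^2^2) \<Rightarrow> complex^2^2"
  where "A3 l = (\<lambda>(Z, W). \<Sum>m\<in>idx (l - 1). \<Sum>n\<in>idx (l - 1/2).
    (1 / (2 * l)) *\<^sub>R (f3 l m n Z \<odot> gt3 l m n W))"

definition B1 :: "real \<Rightarrow> (complex^2^2) \<times> (complex^2^2) \<Rightarrow> complex^2^2"
  where "B1 l = (\<lambda>(Z, W). \<Sum>m\<in>idx (l + 1/2). \<Sum>n\<in>idx l.
    (1 / (2 * l + 1)) *\<^sub>R (ft1 l m n Z \<odot> g1 l m n W))"

definition B2 :: "real \<Rightarrow> (complex^2^2) \<times> (complex^2^2) \<Rightarrow> complex^2^2"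
  where "B2 l = (\<lambda>(Z, W). \<Sum>m\<in>idx (l - 1/2). \<Sum>n\<in>idx l.
    (1 / (2 * l * (2 * l + 1))) *\<^sub>R (ft2 l m n Z \<odot> g2 l m n W))"

definition B3 :: "real \<Rightarrow> (complex^2^2) \<times> (complex^2^2) \<Rightarrow> complex^2^2"
  where "B3 l = (\<lambda>(Z, W). \<Sum>m\<in>idx (l - 1/2). \<Sum>n\<in>idx (l - 1).
    (1 / (2 * l)) *\<^sub>R (ft3 l m n Z \<odot> g3 l m n W))"

text \<open>
  \<open>half_series a A\<close> are the partial sums of the series of \<open>A l\<close>
  over \<open>l = a, a + 1/2, a + 1, \<dots>\<close>, and \<open>half_suminf a A\<close> is its value.
\<close>

definition half_series ::
    "real \<Rightarrow> (real \<Rightarrow> 'p \<Rightarrow> complex^2^2) \<Rightarrow> nat \<Rightarrow> 'p \<Rightarrow> complex^2^2"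
  where "half_series a A L p = (\<Sum>k<L. A (a + real k / 2) p)"

definition half_suminf :: "real \<Rightarrow> (real \<Rightarrow> 'p \<Rightarrow> complex^2^2) \<Rightarrow> 'p \<Rightarrow> complex^2^2"
  where "half_suminf a A p = (\<Sum>k. A (a + real k / 2) p)"

definition unif_conv_on_compacts ::
    "('p::topological_space) set \<Rightarrow> (nat \<Rightarrow> 'p \<Rightarrow> complex^2^2) \<Rightarrow> bool"
  where "unif_conv_on_compacts R S \<longleftrightarrow>
    (\<forall>K. compact K \<longrightarrow> K \<subseteq> R \<longrightarrow> uniformly_convergent_on K S)"

end

theory Submission
  imports Defs "HOL-Complex_Analysis.Cauchy_Integral_Formula"
begin

text \<open>
  \<^bold>\<open>Symmetric powers.\<close> The number \<open>t l n m Z\<close> is the coefficient of \<open>s\<close> to the power \<open>l - n\<close> in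
  \<open>(s z\<^sub>1\<^sub>1 + z\<^sub>2\<^sub>1)^(l - m) (s z\<^sub>1\<^sub>2 + z\<^sub>2\<^sub>2)^(l + m)\<close>, that is, a matrix entry of \<open>Z\<close> acting on
  binary forms of degree \<open>2 l\<close>. These matrices are multiplicative (\<open>sym_entry_mult\<close>), and multiplying
  a form by a linear form, or differentiating it, changes the degree by one. In a product of an
  \<open>f\<close> and a \<open>g\<close>, these two facts turn the sum over one of the indices \<open>m\<close>, \<open>n\<close> into matrix entries of the
  symmetric power of \<open>B = W\<inverse> Z\<close> alone. The remaining sum is a weighted trace: it is an entry of the
  transposed gradient \<open>sym_grad J B\<close> of the character \<open>\<chi> (J + 1) B\<close>, the trace of the symmetric power of
  degree \<open>J + 1\<close>.

  \<^bold>\<open>The gradient.\<close> The character depends only on \<open>\<tau> = trace B\<close> and \<open>\<delta> = det B\<close>, because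
  \<open>\<Sum>n. \<chi> n x^n = 1 / (1 - \<tau> x + \<delta> x\<^sup>2)\<close>. With \<open>a n = \<partial>\<chi> n / \<partial>\<tau>\<close> this series also gives
  \<open>\<partial>\<chi> n / \<partial>\<delta> = - a (n - 1)\<close>, so the chain rule makes the gradient a combination of \<open>1\<close> and the adjugate
  of \<open>B\<close> with coefficients \<open>a (J + 1)\<close> and \<open>- a J\<close>. The lemma \<open>sym_trace_sym_grad\<close> proves
  this by induction on \<open>J\<close>, using \<open>sym_grad (J + 1) B = \<chi> (J + 1) B \<cdot> 1 + sym_grad J B \<cdot> B\<close> in place of derivatives.

  \<^bold>\<open>Closed forms.\<close> Each of \<open>A1\<close>, \<open>A2\<close>, \<open>A3\<close> therefore is a combination of \<open>Z\<close> and \<open>W\<close> whose coefficients are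
  rational multiples of \<open>a (k + 1)\<close> and \<open>a k\<close>, up to powers of \<open>\<delta>\<close> and \<open>1 / N(W)\<close>. The sums \<open>B1\<close>, \<open>B2\<close>, \<open>B3\<close> are
  the same expressions with \<open>Z\<close> and \<open>W\<close> exchanged. The kernel changes sign under the exchange, so
  one expansion implies the other.

  \<^bold>\<open>Convergence and sum.\<close> Each region forces the eigenvalues of the matrix in \<open>Dplus\<close> into the open unit
  disk. This is a condition on trace and determinant alone, hence the same for \<open>Z W\<inverse>\<close> as for \<open>W\<inverse> Z\<close>, which
  makes the second region fit the first after the exchange. On a compact set the eigenvalues stay in a disk of radius \<open>r < 1\<close>,
  which bounds \<open>a n\<close> by a summable sequence (\<open>char_coeff_majorant\<close>), and the Weierstrass test applies to
  each of the series. In the combination \<open>- A1 + A2 + A3\<close> the term with index \<open>k\<close> is \<open>\<chi> k (Z - W) / N(W)\<close>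
  plus two telescoping differences (\<open>kernel_term_telescopes\<close>). Since \<open>\<Sum>k. \<chi> k = 1 / (1 - \<tau> + \<delta>)\<close> and
  \<open>N(Z - W) = N(W) (1 - \<tau> + \<delta>)\<close>, the sum is the kernel.
\<close>

section \<open>The functions \<open>t\<close> as matrix entries of symmetric powers\<close>

definition sym_poly :: "nat \<Rightarrow> nat \<Rightarrow> complex^2^2 \<Rightarrow> complex poly"
  where "sym_poly J q Z = [:Z$2$1, Z$1$1:] ^ q * [:Z$2$2, Z$1$2:] ^ (J - q)"

text \<open>
  The row index \<open>p\<close> is the exponent \<open>l - n\<close> and the column index \<open>q\<close> is \<open>l - m\<close>, with \<open>J = 2 l\<close>. They are integers
  because the formulas shift both indices by one beyond the ends of their ranges, where the value \<open>0\<close>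
  makes recurrences hold without boundary cases.
\<close>

definition sym_entry :: "nat \<Rightarrow> int \<Rightarrow> int \<Rightarrow> complex^2^2 \<Rightarrow> complex"
  where "sym_entry J p q Z =
    (if 0 \<le> p \<and> 0 \<le> q \<and> q \<le> int J then coeff (sym_poly J (nat q) Z) (nat p) else 0)"

lemma has_contour_integral_poly_over_power:
  "((\<lambda>s. poly P s / s ^ Suc p) has_contour_integral 2 * of_real pi * \<i> * coeff P p) (circlepath 0 1)"
proof (induction p arbitrary: P)
  case 0
  have "((\<lambda>s. poly P s / (s - 0)) has_contour_integral 2 * of_real pi * \<i> * poly P 0) (circlepath 0 1)"
    by (rule Cauchy_integral_circlepath_simple) (auto intro!: holomorphic_intros)
  then show ?case by (simp add: poly_0_coeff_0)
next
  case (Suc p)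
  \<comment> \<open>Split off the constant coefficient: its multiple of a negative power below -1 has a primitive off 0, and one factor s cancels in the rest.\<close>
  obtain a Q where P: "P = pCons a Q" by (cases P)
  have "((\<lambda>s. a / s ^ Suc (Suc p)) has_contour_integral 0) (circlepath 0 1)"
  proof (rule Cauchy_theorem_primitive[where S = "- {0}" and f = "\<lambda>s. - a / of_nat (Suc p) * inverse s ^ Suc p"])
    fix s :: complex assume s: "s \<in> - {0}"
    have "1 + of_nat p \<noteq> (0::complex)" by (metis of_nat_Suc of_nat_eq_0_iff nat.distinct(1))
    with s show "((\<lambda>s. - a / of_nat (Suc p) * inverse s ^ Suc p) has_field_derivative a / s ^ Suc (Suc p)) (at s within - {0})"
      by (auto intro!: derivative_eq_intros simp del: power_Suc) (simp add: divide_simps)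
  qed (auto simp: path_image_circlepath)
  from has_contour_integral_add[OF this Suc.IH[of Q]]
  have "((\<lambda>s. a / s ^ Suc (Suc p) + poly Q s / s ^ Suc p) has_contour_integral
      2 * of_real pi * \<i> * coeff P (Suc p)) (circlepath 0 1)"
    by (simp add: P)
  then show ?case
    by (rule has_contour_integral_eq) (auto simp: P divide_simps)
qed

lemma idx_half: "real J / 2 - of_int q \<in> idx (real J / 2) \<longleftrightarrow> 0 \<le> q \<and> q \<le> int J"
proof -
  have "real_of_int q \<le> real J \<longleftrightarrow> q \<le> int J" by (metis of_int_le_iff of_int_of_nat_eq)
  then show ?thesis by (auto simp: idx_def)
qed

lemma sum_idx_half:
  "(\<Sum>m\<in>idx (real J / 2). f m) = (\<Sum>q=0..int J. f (real J / 2 - of_int q))"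
proof (rule sum.reindex_bij_betw[symmetric])
  have "m \<in> (\<lambda>q. real J / 2 - of_int q) ` {0..int J}" if m: "m \<in> idx (real J / 2)" for m
  proof -
    obtain k where "m - real J / 2 = of_int k" using m by (auto simp: idx_def elim: Ints_cases)
    then have "m = real J / 2 - of_int (- k)" by simp
    with m idx_half show ?thesis by (metis atLeastAtMost_iff image_eqI)
  qed
  then show "bij_betw (\<lambda>q. real J / 2 - of_int q) {0..int J} (idx (real J / 2))"
    by (auto simp: bij_betw_def inj_on_def idx_half)
qed

lemma degree_sym_poly: assumes "q \<le> J" shows "degree (sym_poly J q Z) \<le> J"
proof -
  have "degree ([:a, b:] ^ k) \<le> k" for a b :: complex and k
    by (rule order.trans[OF degree_power_le]) auto
  then have "degree (sym_poly J q Z) \<le> q + (J - q)"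
    unfolding sym_poly_def by (intro order.trans[OF degree_mult_le] add_mono)
  with assms show ?thesis by simp
qed

lemma sym_entry_row_gt: "p > int J \<Longrightarrow> sym_entry J p q Z = 0"
  using degree_sym_poly[of "nat q" J Z] by (force simp: sym_entry_def intro!: coeff_eq_0)

lemma t_eq_sym_entry:
  "t (real J / 2) (real J / 2 - of_int p) (real J / 2 - of_int q) Z = sym_entry J p q Z"
proof (cases "0 \<le> p \<and> p \<le> int J \<and> 0 \<le> q \<and> q \<le> int J")
  case True
  then have ex: "nat \<lfloor>real J / 2 - (real J / 2 - of_int q)\<rfloor> = nat q"
    "nat \<lfloor>real J / 2 + (real J / 2 - of_int q)\<rfloor> = J - nat q"
    "\<lfloor>- (real J / 2) + (real J / 2 - of_int p)\<rfloor> = - p"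
    by auto
  have "((\<lambda>s. (s * Z$1$1 + Z$2$1) ^ nat q * (s * Z$1$2 + Z$2$2) ^ (J - nat q) * s powi (- p) / s)
      has_contour_integral 2 * of_real pi * \<i> * coeff (sym_poly J (nat q) Z) (nat p)) (circlepath 0 1)"
    using True
    by (intro has_contour_integral_eq[OF has_contour_integral_poly_over_power])
       (auto simp: sym_poly_def power_int_minus power_int_def field_simps)
  from contour_integral_unique[OF this] show ?thesis
    using True unfolding t_def ex idx_half by (simp add: sym_entry_def)
next
  case False
  then show ?thesis
    using sym_entry_row_gt[of J p q Z] by (auto simp: t_def idx_half sym_entry_def)
qed

lemma nat_eq_Suc_imp: "nat p = Suc k \<Longrightarrow> nat (p - 1) = k"
  by simp

text \<open>
  Raising an exponent by one multiplies the form by one of the two linear forms. This relates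
  degree \<open>J + 1\<close> to degree \<open>J\<close>, for each of the two factors.
\<close>

lemma sym_entry_Suc_left:
  assumes "0 \<le> q" "q \<le> int J"
  shows "sym_entry (Suc J) p (q + 1) Z = Z$1$1 * sym_entry J (p - 1) q Z + Z$2$1 * sym_entry J p q Z"
proof -
  have "sym_poly (Suc J) (nat (q + 1)) Z = [:Z$2$1, Z$1$1:] * sym_poly J (nat q) Z"
    using assms by (simp add: sym_poly_def nat_add_distrib algebra_simps)
  then show ?thesis using assms
    by (cases "p = 0") (auto simp: sym_entry_def coeff_pCons nat_eq_Suc_imp split: nat.split)
qed

lemma sym_entry_Suc_right:
  assumes "0 \<le> q" "q \<le> int J"
  shows "sym_entry (Suc J) p q Z = Z$1$2 * sym_entry J (p - 1) q Z + Z$2$2 * sym_entry J p q Z"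
proof -
  have "Suc J - nat q = Suc (J - nat q)" using assms by auto
  then have "sym_poly (Suc J) (nat q) Z = [:Z$2$2, Z$1$2:] * sym_poly J (nat q) Z"
    using assms by (simp add: sym_poly_def algebra_simps)
  then show ?thesis using assms
    by (cases "p = 0") (auto simp: sym_entry_def coeff_pCons nat_eq_Suc_imp split: nat.split)
qed

text \<open>
  Substituting \<open>X\<close> and \<open>Y\<close> for the two variables of a binary form of degree \<open>J\<close>, where the form is
  given by its dehomogenization \<open>G\<close>.
\<close>

definition hom_subst :: "nat \<Rightarrow> complex poly \<Rightarrow> complex poly \<Rightarrow> complex poly \<Rightarrow> complex poly"
  where "hom_subst J G X Y = (\<Sum>p\<le>J. smult (coeff G p) (X ^ p * Y ^ (J - p)))"

lemma hom_subst_linear_mult: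
  assumes "degree G \<le> J"
  shows "hom_subst (Suc J) ([:b, a:] * G) X Y = (smult a X + smult b Y) * hom_subst J G X Y"
proof -
  have "hom_subst (Suc J) ([:b, a:] * G) X Y =
     (\<Sum>p\<le>Suc J. smult (b * coeff G p) (X ^ p * Y ^ (Suc J - p))) +
     (\<Sum>p\<le>Suc J. smult (coeff (pCons 0 (smult a G)) p) (X ^ p * Y ^ (Suc J - p)))"
    unfolding hom_subst_def by (simp add: smult_add_left sum.distrib)
  also have "(\<Sum>p\<le>Suc J. smult (b * coeff G p) (X ^ p * Y ^ (Suc J - p))) =
      (\<Sum>p\<le>J. smult (b * coeff G p) (X ^ p * Y ^ (Suc J - p)))"
    using assms by (simp add: coeff_eq_0)
  also have "\<dots> = smult b Y * hom_subst J G X Y"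
    unfolding hom_subst_def sum_distrib_left
    by (intro sum.cong) (auto simp: Suc_diff_le mult_ac)
  also have "(\<Sum>p\<le>Suc J. smult (coeff (pCons 0 (smult a G)) p) (X ^ p * Y ^ (Suc J - p))) =
      smult a X * hom_subst J G X Y"
    unfolding hom_subst_def sum_distrib_left sum.atMost_Suc_shift
    by (simp add: mult_ac)
  finally show ?thesis by (simp add: algebra_simps)
qed

lemma hom_subst_sym_poly:
  assumes "q \<le> J"
  shows "hom_subst J (sym_poly J q Z) X Y =
    (smult (Z$1$1) X + smult (Z$2$1) Y) ^ q * (smult (Z$1$2) X + smult (Z$2$2) Y) ^ (J - q)"
  using assms
proof (induction q arbitrary: J)
  case 0
  show ?case
  proof (induction J)
    case 0
    show ?case by (simp add: hom_subst_def sym_poly_def)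
  next
    case (Suc J)
    have "sym_poly (Suc J) 0 Z = [:Z$2$2, Z$1$2:] * sym_poly J 0 Z" by (simp add: sym_poly_def)
    then show ?case using hom_subst_linear_mult[OF degree_sym_poly[of 0 J Z]] Suc by simp
  qed
next
  case (Suc q)
  then obtain J' where J: "J = Suc J'" by (cases J) auto
  have "sym_poly J (Suc q) Z = [:Z$2$1, Z$1$1:] * sym_poly J' q Z"
    by (simp only: sym_poly_def J power_Suc mult.assoc diff_Suc_Suc)
  then show ?case
    using hom_subst_linear_mult[OF degree_sym_poly[of q J' Z]] Suc by (simp add: J mult.assoc)
qed

lemma sum_int_atLeast0: "(\<Sum>q=0..int J. f q) = (\<Sum>q\<le>J. f (int q))"
  by (rule sum.reindex_bij_witness[of _ int nat]) auto

lemma sum_int_Suc_top: "(\<Sum>q=0..int (Suc J). f q) = (\<Sum>q=0..int J. f q) + f (int J + 1)"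
  unfolding sum_int_atLeast0 by (simp add: add.commute)

lemma sum_int_Suc_bot: "(\<Sum>q=0..int (Suc J). f q) = f 0 + (\<Sum>q=0..int J. f (q + 1))"
  unfolding sum_int_atLeast0 sum.atMost_Suc_shift by (simp add: add.commute)

text \<open>
  The action on binary forms is a substitution of linear forms, and composing two such
  substitutions multiplies their matrices.
\<close>

lemma sym_entry_mult:
  "(\<Sum>r=0..int J. sym_entry J p r V * sym_entry J r q Z) = sym_entry J p q (V ** Z)"
proof (cases "0 \<le> p \<and> 0 \<le> q \<and> q \<le> int J")
  case True
  have "sym_poly J (nat q) (V ** Z) =
      hom_subst J (sym_poly J (nat q) Z) [:V$2$1, V$1$1:] [:V$2$2, V$1$2:]"
    using True by (subst hom_subst_sym_poly)
      (auto simp: sym_poly_def matrix_matrix_mult_def sum_2 mult_ac)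
  also have "\<dots> = (\<Sum>r\<le>J. smult (coeff (sym_poly J (nat q) Z) r) (sym_poly J r V))"
    by (simp add: hom_subst_def sym_poly_def)
  finally show ?thesis
    using True by (simp add: sum_int_atLeast0 sym_entry_def coeff_sum mult.commute)
next
  case False
  then show ?thesis by (auto simp: sym_entry_def intro!: sum.neutral)
qed

text \<open>
  A row index weighted by itself comes from a partial derivative of the form
  \<open>(x z\<^sub>1\<^sub>1 + y z\<^sub>2\<^sub>1)^q (x z\<^sub>1\<^sub>2 + y z\<^sub>2\<^sub>2)^(J + 1 - q)\<close>: this lemma is its derivative in \<open>x\<close>, the next one its derivative in \<open>y\<close>.
\<close>

lemma sym_entry_row_left:
  assumes "0 \<le> q" "q \<le> int (Suc J)"
  shows "of_int (p + 1) * sym_entry (Suc J) (p + 1) q Z =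
    Z$1$1 * (of_int q * sym_entry J p (q - 1) Z) + Z$1$2 * (of_int (int J + 1 - q) * sym_entry J p q Z)"
proof (cases "p < 0")
  case True
  then show ?thesis by (cases "p = -1") (auto simp: sym_entry_def)
next
  case False
  define k where "k = nat q"
  have q: "q = int k" and k: "k \<le> Suc J" using assms by (auto simp: k_def)
  define x y where "x = [:Z$2$1, Z$1$1:]" and "y = [:Z$2$2, Z$1$2:]"
  have "pderiv (sym_poly (Suc J) k Z) =
      smult (Z$1$1 * of_nat k) (x ^ (k - 1) * y ^ (Suc J - k)) +
      smult (Z$1$2 * of_nat (Suc J - k)) (x ^ k * y ^ (Suc J - k - 1))"
    unfolding sym_poly_def x_def [symmetric] y_def [symmetric]
    by (simp add: pderiv_mult pderiv_power x_def y_def pderiv_pCons mult_ac add_ac)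
  also have "smult (Z$1$1 * of_nat k) (x ^ (k - 1) * y ^ (Suc J - k)) =
      smult (Z$1$1 * of_nat k) (sym_poly J (k - 1) Z)"
    by (cases k) (auto simp: sym_poly_def x_def y_def)
  also have "x ^ k * y ^ (Suc J - k - 1) = sym_poly J k Z"
    by (simp add: sym_poly_def x_def y_def)
  finally have "coeff (pderiv (sym_poly (Suc J) k Z)) (nat p) =
      Z$1$1 * of_nat k * coeff (sym_poly J (k - 1) Z) (nat p) +
      Z$1$2 * of_nat (Suc J - k) * coeff (sym_poly J k Z) (nat p)"
    by simp
  moreover have "of_nat k * coeff (sym_poly J (k - 1) Z) (nat p) = of_int q * sym_entry J p (q - 1) Z"
    using False k by (cases k) (auto simp: sym_entry_def q)
  moreover have "of_nat (Suc J - k) * coeff (sym_poly J k Z) (nat p) =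
      of_int (int J + 1 - q) * sym_entry J p q Z"
    using False k by (cases "k = Suc J") (auto simp: sym_entry_def q of_nat_diff)
  moreover have "coeff (pderiv (sym_poly (Suc J) k Z)) (nat p) =
      of_int (p + 1) * sym_entry (Suc J) (p + 1) q Z"
    using False k by (auto simp: coeff_pderiv sym_entry_def q nat_add_distrib)
  ultimately show ?thesis by (simp only: mult.assoc)
qed

lemma sym_entry_row_right:
  assumes "0 \<le> q" "q \<le> int (Suc J)"
  shows "of_int (int J + 1 - p) * sym_entry (Suc J) p q Z =
    Z$2$1 * (of_int q * sym_entry J p (q - 1) Z) + Z$2$2 * (of_int (int J + 1 - q) * sym_entry J p q Z)"
proof -
  let ?e = "sym_entry (Suc J) p q Z"
  \<comment> \<open>By the identity of Euler, the derivative in y is the degree times the form minus x times the derivative in x.\<close>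
  have 1: "of_int q * ?e = of_int q * (Z$1$1 * sym_entry J (p - 1) (q - 1) Z + Z$2$1 * sym_entry J p (q - 1) Z)"
    using sym_entry_Suc_left[of "q - 1" J p Z] assms by (cases "q = 0") auto
  have 2: "of_int (int J + 1 - q) * ?e =
      of_int (int J + 1 - q) * (Z$1$2 * sym_entry J (p - 1) q Z + Z$2$2 * sym_entry J p q Z)"
    using sym_entry_Suc_right[of q J p Z] assms by (cases "q = int J + 1") auto
  have 3: "of_int p * ?e = Z$1$1 * (of_int q * sym_entry J (p - 1) (q - 1) Z) +
      Z$1$2 * (of_int (int J + 1 - q) * sym_entry J (p - 1) q Z)"
    using sym_entry_row_left[OF assms, of "p - 1" Z] by simp
  have "of_int (int J + 1 - p) * ?e = of_int q * ?e + of_int (int J + 1 - q) * ?e - of_int p * ?e"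
    by (simp add: algebra_simps)
  then show ?thesis unfolding 1 2 3 by (simp add: algebra_simps)
qed

section \<open>The gradient of the character of a symmetric power\<close>

definition adjugate :: "complex^2^2 \<Rightarrow> complex^2^2"
  where "adjugate Z = vector [vector [Z$2$2, - Z$1$2], vector [- Z$2$1, Z$1$1]]"

definition sym_trace :: "nat \<Rightarrow> complex^2^2 \<Rightarrow> complex"
  where "sym_trace J B = (\<Sum>q=0..int J. sym_entry J q q B)"

text \<open>
  The transposed gradient of \<open>sym_trace (J + 1)\<close> at \<open>B\<close>, with the differentiations carried out:
  differentiating \<open>X^q\<close> or \<open>Y^(J + 1 - q)\<close> produces the exponent as a weight and lowers the degree by one.
\<close>

definition sym_grad :: "nat \<Rightarrow> complex^2^2 \<Rightarrow> complex^2^2"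
  where "sym_grad J B = vector
    [vector [\<Sum>q=0..int J. of_int (q + 1) * sym_entry J q q B,
             \<Sum>q=0..int J. of_int (q + 1) * sym_entry J (q + 1) q B],
     vector [\<Sum>q=0..int J. of_int (int J + 1 - q) * sym_entry J (q - 1) q B,
             \<Sum>q=0..int J. of_int (int J + 1 - q) * sym_entry J q q B]]"

lemma sym_grad_0: "sym_grad 0 B = mat 1"
  by (simp add: sym_grad_def vec_eq_iff forall_2 mat_def sym_entry_def sym_poly_def)

text \<open>
  At each index the two weights add up to the constant \<open>J + 2\<close>.
\<close>

lemma trace_sym_grad: "trace (sym_grad J B) = (of_nat J + 2) * sym_trace J B"
proof -
  have "trace (sym_grad J B) =
     (\<Sum>q=0..int J. (of_int (q + 1) + of_int (int J + 1 - q)) * sym_entry J q q B)"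
    by (simp add: trace_def sum_2 sym_grad_def sum.distrib [symmetric] distrib_right [symmetric]
             del: of_int_add of_int_diff)
  also have "\<dots> = (of_nat J + 2) * sym_trace J B"
    by (simp add: sym_trace_def sum_distrib_left add.commute)
  finally show ?thesis .
qed

text \<open>
  The recurrences raising an exponent, applied to one factor at a time: the weight \<open>q + 1\<close> of the raised index
  is \<open>1 + q\<close>, and the summand \<open>1\<close> contributes the trace on the diagonal. In terms of generating
  functions, the transposed gradients are the coefficients of \<open>(1 - x B)\<inverse> / det (1 - x B)\<close>.
\<close>

lemma sym_grad_Suc: "sym_grad (Suc J) B = mat (sym_trace (Suc J) B) + sym_grad J B ** B"
proof -
  have l: "sym_entry (Suc J) p (q + 1) B = B$1$1 * sym_entry J (p - 1) q B + B$2$1 * sym_entry J p q B"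
    and r: "sym_entry (Suc J) p q B = B$1$2 * sym_entry J (p - 1) q B + B$2$2 * sym_entry J p q B"
    if "q \<in> {0..int J}" for p q
    using that sym_entry_Suc_left sym_entry_Suc_right by auto
  have 11: "(\<Sum>q=0..int (Suc J). of_int (q + 1) * sym_entry (Suc J) q q B) = sym_trace (Suc J) B +
      ((\<Sum>q=0..int J. of_int (q + 1) * sym_entry J q q B) * B$1$1 +
       (\<Sum>q=0..int J. of_int (q + 1) * sym_entry J (q + 1) q B) * B$2$1)"
  proof -
    have "(\<Sum>q=0..int (Suc J). of_int (q + 1) * sym_entry (Suc J) q q B) =
       sym_trace (Suc J) B + (\<Sum>q=0..int (Suc J). of_int q * sym_entry (Suc J) q q B)"
      by (simp add: sym_trace_def sum.distrib distrib_right add.commute)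
    also have "(\<Sum>q=0..int (Suc J). of_int q * sym_entry (Suc J) q q B) =
       (\<Sum>q=0..int J. of_int (q + 1) * (B$1$1 * sym_entry J q q B + B$2$1 * sym_entry J (q + 1) q B))"
      unfolding sum_int_Suc_bot by (auto simp: l intro!: sum.cong)
    finally show ?thesis
      by (simp add: sum_distrib_left sum_distrib_right sum.distrib algebra_simps)
  qed
  have 12: "(\<Sum>q=0..int (Suc J). of_int (q + 1) * sym_entry (Suc J) (q + 1) q B) =
      (\<Sum>q=0..int J. of_int (q + 1) * sym_entry J q q B) * B$1$2 +
      (\<Sum>q=0..int J. of_int (q + 1) * sym_entry J (q + 1) q B) * B$2$2"
  proof -
    have "(\<Sum>q=0..int (Suc J). of_int (q + 1) * sym_entry (Suc J) (q + 1) q B) =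
      (\<Sum>q=0..int J. of_int (q + 1) * (B$1$2 * sym_entry J q q B + B$2$2 * sym_entry J (q + 1) q B))"
      unfolding sum_int_Suc_top by (auto simp: r sym_entry_row_gt intro!: sum.cong)
    then show ?thesis
      by (simp add: sum_distrib_left sum_distrib_right sum.distrib algebra_simps)
  qed
  have 21: "(\<Sum>q=0..int (Suc J). of_int (int (Suc J) + 1 - q) * sym_entry (Suc J) (q - 1) q B) =
      (\<Sum>q=0..int J. of_int (int J + 1 - q) * sym_entry J (q - 1) q B) * B$1$1 +
      (\<Sum>q=0..int J. of_int (int J + 1 - q) * sym_entry J q q B) * B$2$1"
  proof -
    have "sym_entry (Suc J) (- 1) 0 B = 0" by (simp add: sym_entry_def)
    then have "(\<Sum>q=0..int (Suc J). of_int (int (Suc J) + 1 - q) * sym_entry (Suc J) (q - 1) q B) =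
      (\<Sum>q=0..int J. of_int (int J + 1 - q) * (B$1$1 * sym_entry J (q - 1) q B + B$2$1 * sym_entry J q q B))"
      unfolding sum_int_Suc_bot by (auto simp: l algebra_simps intro!: sum.cong)
    then show ?thesis
      by (simp add: sum_distrib_left sum_distrib_right sum.distrib sum_subtractf algebra_simps)
  qed
  have 22: "(\<Sum>q=0..int (Suc J). of_int (int (Suc J) + 1 - q) * sym_entry (Suc J) q q B) =
      sym_trace (Suc J) B +
      ((\<Sum>q=0..int J. of_int (int J + 1 - q) * sym_entry J (q - 1) q B) * B$1$2 +
      (\<Sum>q=0..int J. of_int (int J + 1 - q) * sym_entry J q q B) * B$2$2)"
  proof -
    have "(\<Sum>q=0..int (Suc J). of_int (int (Suc J) + 1 - q) * sym_entry (Suc J) q q B) =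
      sym_trace (Suc J) B + (\<Sum>q=0..int (Suc J). of_int (int J + 1 - q) * sym_entry (Suc J) q q B)"
      by (simp add: sym_trace_def sum.distrib [symmetric] algebra_simps)
    also have "(\<Sum>q=0..int (Suc J). of_int (int J + 1 - q) * sym_entry (Suc J) q q B) =
       (\<Sum>q=0..int J. of_int (int J + 1 - q) * (B$1$2 * sym_entry J (q - 1) q B + B$2$2 * sym_entry J q q B))"
      unfolding sum_int_Suc_top by (auto simp: r intro!: sum.cong)
    finally show ?thesis
      by (simp add: sum_distrib_left sum_distrib_right sum.distrib sum_subtractf algebra_simps)
  qed
  show ?thesis
    unfolding sym_grad_def vec_eq_iff forall_2 
    using 11 12 21 22 by (simp add: mat_def matrix_matrix_mult_def sum_2)
qed

text \<open>
  With \<open>\<tau>\<close> and \<open>\<delta>\<close> the trace and determinant of \<open>B\<close>, this is \<open>det (1 - X B)\<close>. Its inverse generates the traces of the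
  symmetric powers of \<open>B\<close>, and \<open>X\<close> times the square of its inverse generates their derivatives in \<open>\<tau>\<close>.
\<close>

definition char_poly_fps :: "complex \<Rightarrow> complex \<Rightarrow> complex fps"
  where "char_poly_fps \<tau> \<delta> = 1 - fps_const \<tau> * fps_X + fps_const \<delta> * fps_X\<^sup>2"

definition sym_char :: "complex \<Rightarrow> complex \<Rightarrow> nat \<Rightarrow> complex"
  where "sym_char \<tau> \<delta> = fps_nth (inverse (char_poly_fps \<tau> \<delta>))"

definition sym_char_deriv :: "complex \<Rightarrow> complex \<Rightarrow> nat \<Rightarrow> complex"
  where "sym_char_deriv \<tau> \<delta> = fps_nth (fps_X * (inverse (char_poly_fps \<tau> \<delta>))\<^sup>2)"

lemma char_poly_fps_nth_0: "fps_nth (char_poly_fps \<tau> \<delta>) 0 = 1"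
  by (simp add: char_poly_fps_def)

lemma inverse_char_poly_fps: "inverse (char_poly_fps \<tau> \<delta>) * char_poly_fps \<tau> \<delta> = 1"
  by (rule inverse_mult_eq_1) (simp add: char_poly_fps_nth_0)

lemma sym_char_0 [simp]: "sym_char \<tau> \<delta> 0 = 1"
  by (simp add: sym_char_def char_poly_fps_nth_0)

lemma sym_char_deriv_0 [simp]: "sym_char_deriv \<tau> \<delta> 0 = 0"
  and sym_char_deriv_1 [simp]: "sym_char_deriv \<tau> \<delta> (Suc 0) = 1"
  by (simp_all add: sym_char_deriv_def char_poly_fps_nth_0 power2_eq_square)

text \<open>
  The traces are homogeneous of degree \<open>n + 1\<close> in \<open>B\<close>, and \<open>\<tau>\<close> and \<open>\<delta>\<close> have degrees \<open>1\<close> and \<open>2\<close>: this is the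
  identity of Euler. It is read off from the derivative of the generating series.
\<close>

lemma sym_char_euler:
  "of_nat (Suc n) * sym_char \<tau> \<delta> (Suc n) =
     \<tau> * sym_char_deriv \<tau> \<delta> (Suc n) - 2 * \<delta> * sym_char_deriv \<tau> \<delta> n"
proof -
  let ?P = "char_poly_fps \<tau> \<delta>"
  have P': "fps_deriv ?P = - fps_const \<tau> + fps_const (2 * \<delta>) * fps_X"
    by (simp add: char_poly_fps_def fps_deriv_power power2_eq_square algebra_simps)
  have "fps_deriv (inverse ?P) = (fps_const \<tau> - fps_const (2 * \<delta>) * fps_X) * (inverse ?P)\<^sup>2"
    by (subst fps_inverse_deriv) (auto simp: char_poly_fps_nth_0 P')
  then have "fps_X * fps_deriv (inverse ?P) =
      fps_const \<tau> * (fps_X * (inverse ?P)\<^sup>2) - fps_const (2 * \<delta>) * (fps_X * (fps_X * (inverse ?P)\<^sup>2))"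
    by (simp only: left_diff_distrib right_diff_distrib mult_ac)
  then have "fps_nth (fps_X * fps_deriv (inverse ?P)) (Suc n) =
      \<tau> * sym_char_deriv \<tau> \<delta> (Suc n) - 2 * \<delta> * sym_char_deriv \<tau> \<delta> n"
    by (simp add: sym_char_deriv_def del: fps_X_power_mult_nth)
  then show ?thesis by (simp add: sym_char_def)
qed

lemma sym_char_deriv_recurrence:
  "sym_char_deriv \<tau> \<delta> (Suc (Suc n)) =
     sym_char \<tau> \<delta> (Suc n) + \<tau> * sym_char_deriv \<tau> \<delta> (Suc n) - \<delta> * sym_char_deriv \<tau> \<delta> n"
proof -
  let ?P = "char_poly_fps \<tau> \<delta>"
  let ?A = "fps_X * (inverse ?P)\<^sup>2"
  have "?A * ?P = fps_X * inverse ?P * (inverse ?P * ?P)"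
    by (simp only: power2_eq_square mult_ac)
  then have "?A * ?P = fps_X * inverse ?P"
    by (simp add: inverse_char_poly_fps)
  then have "?A = fps_X * inverse ?P + fps_const \<tau> * (fps_X * ?A) - fps_const \<delta> * (fps_X * (fps_X * ?A))"
    by (simp add: char_poly_fps_def power2_eq_square algebra_simps)
  then have "fps_nth ?A (Suc (Suc n)) = fps_nth (fps_X * inverse ?P + fps_const \<tau> * (fps_X * ?A) -
      fps_const \<delta> * (fps_X * (fps_X * ?A))) (Suc (Suc n))"
    by (rule arg_cong)
  then show ?thesis unfolding sym_char_deriv_def sym_char_def 
    by simp
qed

lemma sym_char_deriv_diff:
  "sym_char_deriv \<tau> \<delta> (Suc (Suc n)) - \<delta> * sym_char_deriv \<tau> \<delta> n =
     of_nat (Suc (Suc n)) * sym_char \<tau> \<delta> (Suc n)"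
proof -
  have "of_nat (Suc (Suc n)) * sym_char \<tau> \<delta> (Suc n) =
      of_nat (Suc n) * sym_char \<tau> \<delta> (Suc n) + sym_char \<tau> \<delta> (Suc n)"
    by (simp add: algebra_simps)
  then show ?thesis unfolding sym_char_euler sym_char_deriv_recurrence by simp
qed

text \<open>
  The recurrence for \<open>sym_grad\<close> determines the gradient once the trace is known. Taking its matrix trace
  and comparing with \<open>trace_sym_grad\<close> gives \<open>(J + 1) sym_trace (J + 1) B\<close> in terms of the previous gradient, and
  Euler's identity recognizes the result.
\<close>

lemma sym_trace_sym_grad:
  fixes B :: "complex^2^2"
  defines "a \<equiv> sym_char_deriv (trace B) (det B)"
  shows "sym_trace J B = sym_char (trace B) (det B) J \<and>
    sym_grad J B = mat (a (Suc J)) - mat (a J) ** adjugate B"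
proof (induction J)
  case 0
  show ?case
    by (simp add: a_def sym_trace_def sym_grad_0 sym_entry_def sym_poly_def)
next
  case (Suc J)
  have step: "sym_grad (Suc J) B = mat (sym_trace (Suc J) B) + (mat (a (Suc J)) - mat (a J) ** adjugate B) ** B"
    using Suc sym_grad_Suc by simp
  have "of_nat (Suc J) * sym_trace (Suc J) B =
      trace B * a (Suc J) - 2 * det B * a J"
    using trace_sym_grad[of "Suc J" B] unfolding step
    by (simp add: trace_def sum_2 matrix_matrix_mult_def mat_def adjugate_def det_2 algebra_simps)
  also have "\<dots> = of_nat (Suc J) * sym_char (trace B) (det B) (Suc J)"
    unfolding a_def sym_char_euler by simp
  finally have tr: "sym_trace (Suc J) B = sym_char (trace B) (det B) (Suc J)"
    by (simp del: of_nat_Suc)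
  have a: "a (Suc (Suc J)) = sym_trace (Suc J) B + trace B * a (Suc J) - det B * a J"
    unfolding tr a_def by (rule sym_char_deriv_recurrence)
  have "sym_grad (Suc J) B = mat (a (Suc (Suc J))) - mat (a (Suc J)) ** adjugate B"
    unfolding step a vec_eq_iff forall_2
    by (simp add: trace_def sum_2 matrix_matrix_mult_def mat_def adjugate_def det_2 algebra_simps)
  with tr show ?case by simp
qed

section \<open>The finite sums in closed form\<close>

lemma t_eq_sym_entryI:
  assumes "2 * l = real J" "of_int p = l - n" "of_int q = l - m"
  shows "t l n m Z = sym_entry J p q Z"
proof -
  have "l = real J / 2" "n = real J / 2 - of_int p" "m = real J / 2 - of_int q" using assms by auto
  then show ?thesis by (simp only: t_eq_sym_entry)
qed

text \<open>
  Contracting entries whose degrees differ by one: lower the higher degree by splitting off one of the two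
  linear forms, then use multiplicativity. The choice of the linear form is dictated by the
  offset of the summation index.
\<close>

lemma sym_entry_contract_right:
  "(\<Sum>p=0..int (Suc J). sym_entry J p q Z * sym_entry (Suc J) r p V) =
     V$1$2 * sym_entry J (r - 1) q (V ** Z) + V$2$2 * sym_entry J r q (V ** Z)"
proof -
  have "(\<Sum>p=0..int (Suc J). sym_entry J p q Z * sym_entry (Suc J) r p V) =
      (\<Sum>p=0..int J. V$1$2 * (sym_entry J (r - 1) p V * sym_entry J p q Z) +
         V$2$2 * (sym_entry J r p V * sym_entry J p q Z))"
    unfolding sum_int_Suc_top
    by (auto simp: sym_entry_row_gt sym_entry_Suc_right algebra_simps intro!: sum.cong)
  also have "\<dots> = V$1$2 * sym_entry J (r - 1) q (V ** Z) + V$2$2 * sym_entry J r q (V ** Z)"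
    by (simp add: sym_entry_mult [symmetric] sum.distrib sum_distrib_left)
  finally show ?thesis .
qed

lemma sym_entry_contract_left:
  "(\<Sum>p=0..int (Suc J). sym_entry J (p - 1) q Z * sym_entry (Suc J) r p V) =
     V$1$1 * sym_entry J (r - 1) q (V ** Z) + V$2$1 * sym_entry J r q (V ** Z)"
proof -
  have "sym_entry J (- 1) q Z = 0" by (simp add: sym_entry_def)
  then have "(\<Sum>p=0..int (Suc J). sym_entry J (p - 1) q Z * sym_entry (Suc J) r p V) =
      (\<Sum>p=0..int J. V$1$1 * (sym_entry J (r - 1) p V * sym_entry J p q Z) +
         V$2$1 * (sym_entry J r p V * sym_entry J p q Z))"
    unfolding sum_int_Suc_bot
    by (auto simp: sym_entry_Suc_left algebra_simps intro!: sum.cong)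
  also have "\<dots> = V$1$1 * sym_entry J (r - 1) q (V ** Z) + V$2$1 * sym_entry J r q (V ** Z)"
    by (simp add: sym_entry_mult [symmetric] sum.distrib sum_distrib_left)
  finally show ?thesis .
qed

text \<open>
  The columns and rows in the integer parameters. In the \<open>A\<close> sums \<open>m\<close> corresponds to \<open>q\<close> and \<open>n\<close> to \<open>p\<close>,
  in the \<open>B\<close> sums it is the other way round.
\<close>

lemma f1_half:
  "f1 (real J / 2) (real J / 2 - of_int q) (real (Suc J) / 2 - of_int p) Z =
     vector [sym_entry J p q Z,
       - sym_entry J (p - 1) q Z]"
proof -
  have "t (real J / 2) (real (Suc J) / 2 - of_int p - 1/2) (real J / 2 - of_int q) Z =
      sym_entry J p q Z"
    by (rule t_eq_sym_entryI) (simp_all add: field_simps)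
  moreover have "t (real J / 2) (real (Suc J) / 2 - of_int p + 1/2) (real J / 2 - of_int q) Z =
      sym_entry J (p - 1) q Z"
    by (rule t_eq_sym_entryI) (simp_all add: field_simps)
  ultimately show ?thesis
    unfolding f1_def by (simp only:)
qed

lemma gt1_half:
  "gt1 (real J / 2) (real J / 2 - of_int q) (real (Suc J) / 2 - of_int p) W =
     vector [of_int (int J + 1 - q) * sym_entry (Suc J) q p (matrix_inv W),
       - of_int (q + 1) * sym_entry (Suc J) (q + 1) p (matrix_inv W)]"
proof -
  have "t (real J / 2 + 1/2) (real J / 2 - of_int q + 1/2) (real (Suc J) / 2 - of_int p) (matrix_inv W) =
      sym_entry (Suc J) q p (matrix_inv W)"
    by (rule t_eq_sym_entryI) (simp_all add: field_simps)
  moreover have "t (real J / 2 + 1/2) (real J / 2 - of_int q - 1/2) (real (Suc J) / 2 - of_int p) (matrix_inv W) =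
      sym_entry (Suc J) (q + 1) p (matrix_inv W)"
    by (rule t_eq_sym_entryI) (simp_all add: field_simps)
  ultimately show ?thesis
    unfolding gt1_def by (simp only:) (simp add: algebra_simps add_divide_distrib)
qed

lemma f2_half:
  "f2 (real (Suc J) / 2) (real (Suc J) / 2 - of_int q) (real J / 2 - of_int p) Z =
     vector [of_int (p + 1) * sym_entry (Suc J) (p + 1) q Z,
       of_int (int J + 1 - p) * sym_entry (Suc J) p q Z]"
proof -
  have "t (real (Suc J) / 2) (real J / 2 - of_int p - 1/2) (real (Suc J) / 2 - of_int q) Z =
      sym_entry (Suc J) (p + 1) q Z"
    by (rule t_eq_sym_entryI) (simp_all add: field_simps)
  moreover have "t (real (Suc J) / 2) (real J / 2 - of_int p + 1/2) (real (Suc J) / 2 - of_int q) Z =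
      sym_entry (Suc J) p q Z"
    by (rule t_eq_sym_entryI) (simp_all add: field_simps)
  ultimately show ?thesis
    unfolding f2_def by (simp only:) (simp add: algebra_simps add_divide_distrib)
qed

lemma gt2_half:
  "gt2 (real (Suc J) / 2) (real (Suc J) / 2 - of_int q) (real J / 2 - of_int p) W =
     inverse (det W) *s vector [sym_entry J (q - 1) p (matrix_inv W),
       sym_entry J q p (matrix_inv W)]"
proof -
  have "t (real (Suc J) / 2 - 1/2) (real (Suc J) / 2 - of_int q + 1/2) (real J / 2 - of_int p) (matrix_inv W) =
      sym_entry J (q - 1) p (matrix_inv W)"
    by (rule t_eq_sym_entryI) (simp_all add: field_simps)
  moreover have "t (real (Suc J) / 2 - 1/2) (real (Suc J) / 2 - of_int q - 1/2) (real J / 2 - of_int p) (matrix_inv W) =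
      sym_entry J q p (matrix_inv W)"
    by (rule t_eq_sym_entryI) (simp_all add: field_simps)
  ultimately show ?thesis
    unfolding gt2_def by (simp only:)
qed

lemma ft1_half:
  "ft1 (real J / 2) (real (Suc J) / 2 - of_int p) (real J / 2 - of_int q) Z =
     vector [sym_entry (Suc J) p q (matrix_inv Z),
       - sym_entry (Suc J) p (q + 1) (matrix_inv Z)]"
proof -
  have "t (real J / 2 + 1/2) (real (Suc J) / 2 - of_int p) (real J / 2 - of_int q + 1/2) (matrix_inv Z) =
      sym_entry (Suc J) p q (matrix_inv Z)"
    by (rule t_eq_sym_entryI) (simp_all add: field_simps)
  moreover have "t (real J / 2 + 1/2) (real (Suc J) / 2 - of_int p) (real J / 2 - of_int q - 1/2) (matrix_inv Z) =
      sym_entry (Suc J) p (q + 1) (matrix_inv Z)"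
    by (rule t_eq_sym_entryI) (simp_all add: field_simps)
  ultimately show ?thesis
    unfolding ft1_def by (simp only:)
qed

lemma g1_half:
  "g1 (real J / 2) (real (Suc J) / 2 - of_int p) (real J / 2 - of_int q) W =
     vector [of_int (int J + 1 - p) * sym_entry J q p W,
       - of_int p * sym_entry J q (p - 1) W]"
proof -
  have "t (real J / 2) (real J / 2 - of_int q) (real (Suc J) / 2 - of_int p - 1/2) W =
      sym_entry J q p W"
    by (rule t_eq_sym_entryI) (simp_all add: field_simps)
  moreover have "t (real J / 2) (real J / 2 - of_int q) (real (Suc J) / 2 - of_int p + 1/2) W =
      sym_entry J q (p - 1) W"
    by (rule t_eq_sym_entryI) (simp_all add: field_simps)
  ultimately show ?thesis
    unfolding g1_def by (simp only:) (simp add: algebra_simps add_divide_distrib)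
qed

lemma ft2_half:
  "ft2 (real (Suc J) / 2) (real J / 2 - of_int p) (real (Suc J) / 2 - of_int q) Z =
     inverse (det Z) *s vector [of_int q * sym_entry J p (q - 1) (matrix_inv Z),
       of_int (int J + 1 - q) * sym_entry J p q (matrix_inv Z)]"
proof -
  have "t (real (Suc J) / 2 - 1/2) (real J / 2 - of_int p) (real (Suc J) / 2 - of_int q + 1/2) (matrix_inv Z) =
      sym_entry J p (q - 1) (matrix_inv Z)"
    by (rule t_eq_sym_entryI) (simp_all add: field_simps)
  moreover have "t (real (Suc J) / 2 - 1/2) (real J / 2 - of_int p) (real (Suc J) / 2 - of_int q - 1/2) (matrix_inv Z) =
      sym_entry J p q (matrix_inv Z)"
    by (rule t_eq_sym_entryI) (simp_all add: field_simps)
  ultimately show ?thesis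
    unfolding ft2_def by (simp only:) (simp add: algebra_simps add_divide_distrib)
qed

lemma g2_half:
  "g2 (real (Suc J) / 2) (real J / 2 - of_int p) (real (Suc J) / 2 - of_int q) W =
     vector [sym_entry (Suc J) q (p + 1) W,
       sym_entry (Suc J) q p W]"
proof -
  have "t (real (Suc J) / 2) (real (Suc J) / 2 - of_int q) (real J / 2 - of_int p - 1/2) W =
      sym_entry (Suc J) q (p + 1) W"
    by (rule t_eq_sym_entryI) (simp_all add: field_simps)
  moreover have "t (real (Suc J) / 2) (real (Suc J) / 2 - of_int q) (real J / 2 - of_int p + 1/2) W =
      sym_entry (Suc J) q p W"
    by (rule t_eq_sym_entryI) (simp_all add: field_simps)
  ultimately show ?thesis
    unfolding g2_def by (simp only:)
qed

text \<open>
  Contracting over \<open>p\<close> and then summing over \<open>q\<close> leaves, in each entry, a sum of two components of \<open>sym_grad J (V ** Z)\<close>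
  multiplied by entries of \<open>V\<close>. The order of the components and the signs are those of an adjugate.
\<close>

lemma sum_f1_gt1:
  fixes Z W defines "V \<equiv> matrix_inv W"
  shows "(\<Sum>m\<in>idx (real J / 2). \<Sum>n\<in>idx (real J / 2 + 1/2). f1 (real J / 2) m n Z \<odot> gt1 (real J / 2) m n W) =
    adjugate (sym_grad J (V ** Z) ** V)"
proof -
  have "real J / 2 + 1/2 = real (Suc J) / 2" by simp
  then have "(\<Sum>m\<in>idx (real J / 2). \<Sum>n\<in>idx (real J / 2 + 1/2). f1 (real J / 2) m n Z \<odot> gt1 (real J / 2) m n W) =
    (\<Sum>q=0..int J. \<Sum>p=0..int (Suc J). vector [sym_entry J p q Z, - sym_entry J (p - 1) q Z] \<odot>
       vector [of_int (int J + 1 - q) * sym_entry (Suc J) q p V,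
       - of_int (q + 1) * sym_entry (Suc J) (q + 1) p V])" (is "_ = ?S")
    by (simp only: sum_idx_half f1_half gt1_half V_def)
  moreover have "?S $ 1 $ 1 = (\<Sum>q=0..int J. of_int (int J + 1 - q) *
      (\<Sum>p=0..int (Suc J). sym_entry J p q Z * sym_entry (Suc J) q p V))"
    by (auto simp: sum_component column_times_row_def sum_distrib_left algebra_simps simp del: sum_negf intro!: sum.cong)
  moreover have "?S $ 1 $ 2 = (\<Sum>q=0..int J. - of_int (q + 1) *
      (\<Sum>p=0..int (Suc J). sym_entry J p q Z * sym_entry (Suc J) (q + 1) p V))"
    by (auto simp: sum_component column_times_row_def sum_distrib_left algebra_simps simp del: sum_negf intro!: sum.cong)
  moreover have "?S $ 2 $ 1 = (\<Sum>q=0..int J. - of_int (int J + 1 - q) *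
      (\<Sum>p=0..int (Suc J). sym_entry J (p - 1) q Z * sym_entry (Suc J) q p V))"
    by (auto simp: sum_component column_times_row_def sum_distrib_left algebra_simps simp del: sum_negf intro!: sum.cong)
  moreover have "?S $ 2 $ 2 = (\<Sum>q=0..int J. of_int (q + 1) *
      (\<Sum>p=0..int (Suc J). sym_entry J (p - 1) q Z * sym_entry (Suc J) (q + 1) p V))"
    by (auto simp: sum_component column_times_row_def sum_distrib_left algebra_simps simp del: sum_negf intro!: sum.cong)
  ultimately show ?thesis
    unfolding sym_entry_contract_left sym_entry_contract_right vec_eq_iff forall_2
    by (simp add: adjugate_def matrix_matrix_mult_def sum_2 sym_grad_def sum_distrib_left sum_distrib_right
        sum.distrib [symmetric] sum_negf [symmetric] algebra_simps)
qed

lemma sum_weighted_Suc_bot: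
  "(\<Sum>q=0..int (Suc J). of_int q * f q) = (\<Sum>q=0..int J. of_int (q + 1) * f (q + 1) :: complex)"
  unfolding sum_int_Suc_bot by simp

lemma sum_weighted_Suc_top:
  "(\<Sum>q=0..int (Suc J). of_int (int J + 1 - q) * f q) =
     (\<Sum>q=0..int J. of_int (int J + 1 - q) * f q :: complex)"
  unfolding sum_int_Suc_top by simp

lemma f2_half_contracted:
  assumes "q \<in> {0..int (Suc J)}"
  shows "f2 (real (Suc J) / 2) (real (Suc J) / 2 - of_int q) (real J / 2 - of_int p) Z =
    vector [Z$1$1 * (of_int q * sym_entry J p (q - 1) Z) + Z$1$2 * (of_int (int J + 1 - q) * sym_entry J p q Z),
            Z$2$1 * (of_int q * sym_entry J p (q - 1) Z) + Z$2$2 * (of_int (int J + 1 - q) * sym_entry J p q Z)]"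
  using assms by (simp only: f2_half atLeastAtMost_iff sym_entry_row_left sym_entry_row_right)

text \<open>
  The weights in \<open>f2\<close> are derivatives, so \<open>f2\<close> is \<open>Z\<close> applied to a weighted column of degree \<open>J\<close>. That column is contracted
  with the row of the same degree in \<open>gt2\<close>.
\<close>

lemma sum_f2_gt2:
  fixes Z W defines "V \<equiv> matrix_inv W"
  shows "(\<Sum>m\<in>idx (real (Suc J) / 2). \<Sum>n\<in>idx (real (Suc J) / 2 - 1/2).
      f2 (real (Suc J) / 2) m n Z \<odot> gt2 (real (Suc J) / 2) m n W) =
    mat (inverse (det W)) ** (Z ** sym_grad J (V ** Z))"
proof -
  have J: "real (Suc J) / 2 - 1/2 = real J / 2" by (simp add: field_simps)
  have "(\<Sum>m\<in>idx (real (Suc J) / 2). \<Sum>n\<in>idx (real (Suc J) / 2 - 1/2).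
      f2 (real (Suc J) / 2) m n Z \<odot> gt2 (real (Suc J) / 2) m n W) =
    (\<Sum>q=0..int (Suc J). \<Sum>p=0..int J.
      vector [Z$1$1 * (of_int q * sym_entry J p (q - 1) Z) + Z$1$2 * (of_int (int J + 1 - q) * sym_entry J p q Z),
            Z$2$1 * (of_int q * sym_entry J p (q - 1) Z) + Z$2$2 * (of_int (int J + 1 - q) * sym_entry J p q Z)] \<odot>
      (inverse (det W) *s vector [sym_entry J (q - 1) p V, sym_entry J q p V]))" (is "_ = ?S")
    unfolding J sum_idx_half V_def
    by (rule sum.cong[OF refl], rule sum.cong[OF refl]) (simp only: f2_half_contracted gt2_half)
  moreover have "?S $ i $ 1 = inverse (det W) *
      (Z$i$1 * (\<Sum>q=0..int (Suc J). of_int q * (\<Sum>p=0..int J. sym_entry J (q - 1) p V * sym_entry J p (q - 1) Z)) +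
       Z$i$2 * (\<Sum>q=0..int (Suc J). of_int (int J + 1 - q) * (\<Sum>p=0..int J. sym_entry J (q - 1) p V * sym_entry J p q Z)))"
    if "i = 1 \<or> i = 2" for i using that
    by (auto simp: sum_component column_times_row_def sum_distrib_left sum.distrib [symmetric] algebra_simps
             intro!: sum.cong)
  moreover have "?S $ i $ 2 = inverse (det W) *
      (Z$i$1 * (\<Sum>q=0..int (Suc J). of_int q * (\<Sum>p=0..int J. sym_entry J q p V * sym_entry J p (q - 1) Z)) +
       Z$i$2 * (\<Sum>q=0..int (Suc J). of_int (int J + 1 - q) * (\<Sum>p=0..int J. sym_entry J q p V * sym_entry J p q Z)))"
    if "i = 1 \<or> i = 2" for i using that
    by (auto simp: sum_component column_times_row_def sum_distrib_left sum.distrib [symmetric] algebra_simps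
             intro!: sum.cong)
  ultimately show ?thesis
    unfolding sym_entry_mult sum_weighted_Suc_bot sum_weighted_Suc_top vec_eq_iff forall_2
    by (simp add: mat_def matrix_matrix_mult_def sum_2 sym_grad_def)
qed

lemma sym_entry_contract_col_right:
  "(\<Sum>q=0..int J. sym_entry (Suc J) p q V * sym_entry J q r W) =
     V$1$2 * sym_entry J (p - 1) r (V ** W) + V$2$2 * sym_entry J p r (V ** W)"
  unfolding sym_entry_mult [symmetric] sum_distrib_left sum.distrib [symmetric]
  by (auto simp: sym_entry_Suc_right algebra_simps intro!: sum.cong)

lemma sym_entry_contract_col_left:
  "(\<Sum>q=0..int J. sym_entry (Suc J) p (q + 1) V * sym_entry J q r W) =
     V$1$1 * sym_entry J (p - 1) r (V ** W) + V$2$1 * sym_entry J p r (V ** W)"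
  unfolding sym_entry_mult [symmetric] sum_distrib_left sum.distrib [symmetric]
  by (auto simp: sym_entry_Suc_left algebra_simps intro!: sum.cong)

lemma sum_ft1_g1:
  fixes Z W defines "V \<equiv> matrix_inv Z"
  shows "(\<Sum>m\<in>idx (real J / 2 + 1/2). \<Sum>n\<in>idx (real J / 2). ft1 (real J / 2) m n Z \<odot> g1 (real J / 2) m n W) =
    adjugate (sym_grad J (V ** W) ** V)"
proof -
  have "real J / 2 + 1/2 = real (Suc J) / 2" by simp
  then have "(\<Sum>m\<in>idx (real J / 2 + 1/2). \<Sum>n\<in>idx (real J / 2). ft1 (real J / 2) m n Z \<odot> g1 (real J / 2) m n W) =
    (\<Sum>p=0..int (Suc J). \<Sum>q=0..int J. vector [sym_entry (Suc J) p q V, - sym_entry (Suc J) p (q + 1) V] \<odot>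
       vector [of_int (int J + 1 - p) * sym_entry J q p W, - of_int p * sym_entry J q (p - 1) W])" (is "_ = ?S")
    by (simp only: sum_idx_half ft1_half g1_half V_def)
  moreover have "?S $ 1 $ 1 = (\<Sum>p=0..int (Suc J). of_int (int J + 1 - p) *
      (\<Sum>q=0..int J. sym_entry (Suc J) p q V * sym_entry J q p W))"
    by (auto simp: sum_component column_times_row_def sum_distrib_left algebra_simps simp del: sum_negf intro!: sum.cong)
  moreover have "?S $ 1 $ 2 = (\<Sum>p=0..int (Suc J). of_int p *
      - (\<Sum>q=0..int J. sym_entry (Suc J) p q V * sym_entry J q (p - 1) W))"
    unfolding sum_negf [symmetric]
    by (auto simp: sum_component column_times_row_def sum_distrib_left algebra_simps simp del: sum_negf intro!: sum.cong)
  moreover have "?S $ 2 $ 1 = (\<Sum>p=0..int (Suc J). of_int (int J + 1 - p) *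
      - (\<Sum>q=0..int J. sym_entry (Suc J) p (q + 1) V * sym_entry J q p W))"
    unfolding sum_negf [symmetric]
    by (auto simp: sum_component column_times_row_def sum_distrib_left algebra_simps simp del: sum_negf intro!: sum.cong)
  moreover have "?S $ 2 $ 2 = (\<Sum>p=0..int (Suc J). of_int p *
      (\<Sum>q=0..int J. sym_entry (Suc J) p (q + 1) V * sym_entry J q (p - 1) W))"
    by (auto simp: sum_component column_times_row_def sum_distrib_left algebra_simps simp del: sum_negf intro!: sum.cong)
  ultimately show ?thesis
    unfolding sym_entry_contract_col_left sym_entry_contract_col_right sum_weighted_Suc_bot sum_weighted_Suc_top
      vec_eq_iff forall_2
    by (simp add: adjugate_def matrix_matrix_mult_def sum_2 sym_grad_def sum_distrib_left sum_distrib_right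
        sum.distrib [symmetric] sum_negf [symmetric] algebra_simps)
qed

lemma g2_half_contracted:
  assumes "p \<in> {0..int J}"
  shows "g2 (real (Suc J) / 2) (real J / 2 - of_int p) (real (Suc J) / 2 - of_int q) W =
    vector [W$1$1 * sym_entry J (q - 1) p W + W$2$1 * sym_entry J q p W,
            W$1$2 * sym_entry J (q - 1) p W + W$2$2 * sym_entry J q p W]"
  using assms by (simp only: g2_half atLeastAtMost_iff sym_entry_Suc_left sym_entry_Suc_right)

text \<open>
  Here \<open>g2\<close> splits off the factor \<open>W\<close> on the right, and the contraction runs over the index of the outer
  sum, which is why the sums are exchanged first.
\<close>

lemma sum_ft2_g2:
  fixes Z W defines "V \<equiv> matrix_inv Z"
  shows "(\<Sum>m\<in>idx (real (Suc J) / 2 - 1/2). \<Sum>n\<in>idx (real (Suc J) / 2).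
      ft2 (real (Suc J) / 2) m n Z \<odot> g2 (real (Suc J) / 2) m n W) =
    mat (inverse (det Z)) ** (sym_grad J (W ** V) ** W)"
proof -
  have J: "real (Suc J) / 2 - 1/2 = real J / 2" by (simp add: field_simps)
  have "(\<Sum>m\<in>idx (real (Suc J) / 2 - 1/2). \<Sum>n\<in>idx (real (Suc J) / 2).
      ft2 (real (Suc J) / 2) m n Z \<odot> g2 (real (Suc J) / 2) m n W) =
    (\<Sum>p=0..int J. \<Sum>q=0..int (Suc J).
      (inverse (det Z) *s vector [of_int q * sym_entry J p (q - 1) V, of_int (int J + 1 - q) * sym_entry J p q V]) \<odot>
      vector [W$1$1 * sym_entry J (q - 1) p W + W$2$1 * sym_entry J q p W,
            W$1$2 * sym_entry J (q - 1) p W + W$2$2 * sym_entry J q p W])"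
    unfolding J sum_idx_half V_def
    by (rule sum.cong[OF refl], rule sum.cong[OF refl]) (simp only: g2_half_contracted ft2_half)
  also have "\<dots> = (\<Sum>q=0..int (Suc J). \<Sum>p=0..int J.
      (inverse (det Z) *s vector [of_int q * sym_entry J p (q - 1) V, of_int (int J + 1 - q) * sym_entry J p q V]) \<odot>
      vector [W$1$1 * sym_entry J (q - 1) p W + W$2$1 * sym_entry J q p W,
            W$1$2 * sym_entry J (q - 1) p W + W$2$2 * sym_entry J q p W])" (is "_ = ?S")
    by (rule sum.swap)
  also have "?S = mat (inverse (det Z)) ** (sym_grad J (W ** V) ** W)"
  proof -
    have "?S $ 1 $ j = inverse (det Z) *
        ((\<Sum>q=0..int (Suc J). of_int q * (\<Sum>p=0..int J. sym_entry J (q - 1) p W * sym_entry J p (q - 1) V)) * W$1$j +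
         (\<Sum>q=0..int (Suc J). of_int q * (\<Sum>p=0..int J. sym_entry J q p W * sym_entry J p (q - 1) V)) * W$2$j)"
      if "j = 1 \<or> j = 2" for j using that
      by (auto simp: sum_component column_times_row_def sum_distrib_left sum_distrib_right sum.distrib [symmetric]
               algebra_simps intro!: sum.cong)
    moreover have "?S $ 2 $ j = inverse (det Z) *
        ((\<Sum>q=0..int (Suc J). of_int (int J + 1 - q) * (\<Sum>p=0..int J. sym_entry J (q - 1) p W * sym_entry J p q V)) * W$1$j +
         (\<Sum>q=0..int (Suc J). of_int (int J + 1 - q) * (\<Sum>p=0..int J. sym_entry J q p W * sym_entry J p q V)) * W$2$j)"
      if "j = 1 \<or> j = 2" for j using that
      by (auto simp: sum_component column_times_row_def sum_distrib_left sum_distrib_right sum.distrib [symmetric]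
               algebra_simps intro!: sum.cong)
    ultimately show ?thesis
      unfolding sym_entry_mult sum_weighted_Suc_bot sum_weighted_Suc_top vec_eq_iff forall_2
      by (simp add: mat_def matrix_matrix_mult_def sum_2 sym_grad_def)
  qed
  finally show ?thesis .
qed

definition rel_trace :: "complex^2^2 \<Rightarrow> complex^2^2 \<Rightarrow> complex"
  where "rel_trace Z W = trace (matrix_inv W ** Z)"

definition rel_det :: "complex^2^2 \<Rightarrow> complex^2^2 \<Rightarrow> complex"
  where "rel_det Z W = det Z / det W"

definition char_coeff :: "nat \<Rightarrow> complex^2^2 \<Rightarrow> complex^2^2 \<Rightarrow> complex"
  where "char_coeff n Z W = sym_char_deriv (rel_trace Z W) (rel_det Z W) n"

lemma matrix_inv_mult_left: "det W \<noteq> 0 \<Longrightarrow> matrix_inv W ** W = mat 1" for W :: "complex^2^2"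
  unfolding matrix_inv_def invertible_det_nz [symmetric] invertible_def by (metis (mono_tags, lifting) someI_ex)

lemma mult_adjugate: "W ** (mat c ** adjugate W) = mat (c * det W)"
  by (simp add: vec_eq_iff forall_2 matrix_matrix_mult_def sum_2 mat_def adjugate_def)
     (simp add: det_2 algebra_simps)

lemma matrix_inv_adjugate: assumes "det W \<noteq> 0" shows "matrix_inv W = mat (inverse (det W)) ** adjugate W"
proof -
  have "matrix_inv W = matrix_inv W ** (W ** (mat (inverse (det W)) ** adjugate W))"
    using assms by (simp add: mult_adjugate)
  also have "\<dots> = mat (inverse (det W)) ** adjugate W"
    by (simp only: matrix_mul_assoc [of "matrix_inv W"] matrix_inv_mult_left[OF assms] matrix_mul_lid)
  finally show ?thesis .
qed

lemma det_matrix_inv: assumes "det W \<noteq> 0" shows "det (matrix_inv W :: complex^2^2) = inverse (det W)"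
proof -
  have "matrix_inv W ** W = mat 1" using assms by (rule matrix_inv_mult_left)
  then have "det (matrix_inv W) * det W = 1" by (metis det_I det_mul)
  then show ?thesis using assms by (simp add: field_simps)
qed

lemma adjugate_matrix_inv: "det W \<noteq> 0 \<Longrightarrow> adjugate (matrix_inv W) = mat (inverse (det W)) ** W"
  by (simp add: matrix_inv_adjugate)
     (simp add: vec_eq_iff forall_2 matrix_matrix_mult_def sum_2 mat_def adjugate_def)

lemma mat_mult_nth: "(mat c ** X) $ i $ j = c * X $ i $ j" for X :: "complex^2^2"
  using exhaust_2[of i] by (auto simp: matrix_matrix_mult_def sum_2 mat_def)

lemma sym_grad_rel:
  assumes "det W \<noteq> 0"
  shows "sym_grad J (matrix_inv W ** Z) =
    mat (char_coeff (Suc J) Z W) - mat (char_coeff J Z W) ** adjugate (matrix_inv W ** Z)"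
  using sym_trace_sym_grad[of J "matrix_inv W ** Z"] assms
  by (simp add: char_coeff_def rel_trace_def rel_det_def det_mul det_matrix_inv divide_inverse mult.commute)

lemma adjugate_combination:
  "adjugate ((mat a - mat b ** adjugate (V ** Z)) ** V) = mat a ** adjugate V - mat (b * det V) ** Z"
  by (simp add: vec_eq_iff forall_2 mat_mult_nth)
     (simp add: matrix_matrix_mult_def sum_2 mat_def adjugate_def det_2 algebra_simps)

lemma mult_adjugate_combination:
  "Z ** (mat a - mat b ** adjugate (V ** Z)) = mat a ** Z - mat (b * det Z) ** adjugate V"
  "(mat a - mat b ** adjugate (Z ** V)) ** Z = mat a ** Z - mat (b * det Z) ** adjugate V"
  by (simp_all add: vec_eq_iff forall_2 mat_mult_nth)
     (simp_all add: matrix_matrix_mult_def sum_2 mat_def adjugate_def det_2 algebra_simps)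

lemma sum_mat_mult: "(\<Sum>x\<in>S. mat c ** X x) = mat c ** (\<Sum>x\<in>S. X x)" for X :: "_ \<Rightarrow> complex^2^2"
  by (simp add: vec_eq_iff mat_mult_nth sum_component sum_distrib_left)

lemma scaleR_eq_mat_mult: "r *\<^sub>R X = mat (of_real r) ** X" for X :: "complex^2^2"
  unfolding vec_eq_iff mat_mult_nth by (simp add: scaleR_conv_of_real [where 'a = complex])

lemma mat_mult_mat_mult: "mat c ** (mat d ** X) = mat (c * d) ** X" for X :: "complex^2^2"
  by (simp add: vec_eq_iff mat_mult_nth)

lemma mult_scale_column_times_row: "(c *s x) \<odot> (d *s y) = mat (c * d) ** (x \<odot> y)"
  by (simp add: vec_eq_iff mat_mult_nth column_times_row_def)

lemma A1_closed:
  assumes "det W \<noteq> 0"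
  shows "A1 (real J / 2) (Z, W) = mat (1 / of_nat (Suc J)) **
    (mat (char_coeff (Suc J) Z W) ** (mat (1 / det W) ** W) - mat (char_coeff J Z W) ** (mat (1 / det W) ** Z))"
proof -
  have l: "2 * (real J / 2) + 1 = real (Suc J)" by simp
  have c: "complex_of_real (1 / real (Suc J)) = 1 / of_nat (Suc J)"
    by (simp only: of_real_divide of_real_1 of_real_of_nat_eq)
  show ?thesis
    unfolding A1_def prod.case scaleR_eq_mat_mult sum_mat_mult sum_f1_gt1 l c
      sym_grad_rel[OF assms] adjugate_combination adjugate_matrix_inv[OF assms] det_matrix_inv[OF assms]
    by (simp add: vec_eq_iff mat_mult_nth divide_inverse right_diff_distrib mult_ac del: of_nat_Suc)
qed

lemma A2_closed:
  assumes "det W \<noteq> 0"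
  shows "A2 (real (Suc J) / 2) (Z, W) = mat (1 / (of_nat (Suc J) * of_nat (Suc (Suc J)))) **
    (mat (char_coeff (Suc J) Z W) ** (mat (1 / det W) ** Z) -
     mat (char_coeff J Z W) ** (mat (rel_det Z W / det W) ** W))"
proof -
  have l: "2 * (real (Suc J) / 2) * (2 * (real (Suc J) / 2) + 1) = real (Suc J) * real (Suc (Suc J))"
    by (simp add: field_simps)
  have c: "complex_of_real (1 / (real (Suc J) * real (Suc (Suc J)))) = 1 / (of_nat (Suc J) * of_nat (Suc (Suc J)))"
    by (simp only: of_real_divide of_real_1 of_real_of_nat_eq of_real_mult)
  show ?thesis
    unfolding A2_def prod.case scaleR_eq_mat_mult sum_mat_mult sum_f2_gt2 l c
      sym_grad_rel[OF assms] mult_adjugate_combination adjugate_matrix_inv[OF assms]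
    by (simp add: vec_eq_iff mat_mult_nth rel_det_def divide_inverse right_diff_distrib mult_ac del: of_nat_Suc)
qed

text \<open>
  The products of the third family at \<open>l + 1\<close> are those of the first family at \<open>l\<close> multiplied by \<open>N(Z) / N(W)\<close>,
  and the prefactors are \<open>1 / (J + 2)\<close> and \<open>1 / (J + 1)\<close> for \<open>J = 2 l\<close>.
\<close>

lemma A3_reduce:
  "A3 (real J / 2 + 1) (Z, W) = mat (rel_det Z W * of_nat (Suc J) / of_nat (Suc (Suc J))) ** A1 (real J / 2) (Z, W)"
proof -
  have idx: "real J / 2 + 1 - 1 = real J / 2" "real J / 2 + 1 - 1 / 2 = real J / 2 + 1 / 2" by simp_all
  have f: "f3 (real J / 2 + 1) m n Z = det Z *s f1 (real J / 2) m n Z" for m n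
    unfolding f3_def f1_def idx ..
  have g: "gt3 (real J / 2 + 1) m n W = inverse (det W) *s gt1 (real J / 2) m n W" for m n
  proof -
    have "real J / 2 + 1 + m = real J / 2 + m + 1" "real J / 2 + 1 - m = real J / 2 - m + 1" by simp_all
    then show ?thesis unfolding gt3_def gt1_def idx by (simp only:)
  qed
  have l: "2 * (real J / 2 + 1) = real (Suc (Suc J))" "2 * (real J / 2) + 1 = real (Suc J)" by simp_all
  have "of_nat (Suc J) \<noteq> (0::complex)" by (simp only: of_nat_eq_0_iff)
  then have c: "complex_of_real (1 / real (Suc (Suc J))) * (det Z * inverse (det W)) =
      rel_det Z W * of_nat (Suc J) / of_nat (Suc (Suc J)) * complex_of_real (1 / real (Suc J))"
    by (simp add: rel_det_def divide_inverse del: of_nat_Suc)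
  show ?thesis
    unfolding A3_def A1_def prod.case f g idx mult_scale_column_times_row scaleR_eq_mat_mult sum_mat_mult mat_mult_mat_mult l c ..
qed

lemma A3_closed:
  assumes "det W \<noteq> 0"
  shows "A3 (real J / 2 + 1) (Z, W) = mat (1 / of_nat (Suc (Suc J))) **
    (mat (char_coeff (Suc J) Z W) ** (mat (rel_det Z W / det W) ** W) -
     mat (char_coeff J Z W) ** (mat (rel_det Z W / det W) ** Z))"
proof -
  have "of_nat (Suc J) \<noteq> (0::complex)" by (simp only: of_nat_eq_0_iff)
  then show ?thesis
  unfolding A3_reduce A1_closed[OF assms]
  by (simp add: vec_eq_iff mat_mult_nth right_diff_distrib mult_ac del: of_nat_Suc)
qed

lemma B1_eq_A1: "B1 (real J / 2) (Z, W) = A1 (real J / 2) (W, Z)"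
  unfolding A1_def B1_def prod.case scaleR_eq_mat_mult sum_mat_mult sum_f1_gt1 sum_ft1_g1 ..

text \<open>
  \<open>sym_grad J (W ** V)\<close> and \<open>sym_grad J (V ** W)\<close> have the same coefficients at the identity and
  the adjugate, because these depend on the trace and the determinant only. This gives \<open>sym_grad J (W ** V) ** W = W ** sym_grad J (V ** W)\<close>.
\<close>

lemma B2_eq_A2: "B2 (real (Suc J) / 2) (Z, W) = A2 (real (Suc J) / 2) (W, Z)"
proof -
  have tr: "trace (W ** matrix_inv Z) = trace (matrix_inv Z ** W)" by (rule trace_mul_sym)
  have "sym_grad J (W ** matrix_inv Z) ** W = W ** sym_grad J (matrix_inv Z ** W)"
    using sym_trace_sym_grad[of J "W ** matrix_inv Z"] sym_trace_sym_grad[of J "matrix_inv Z ** W"]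
    by (simp add: tr det_mul mult.commute mult_adjugate_combination)
  then show ?thesis
    unfolding A2_def B2_def prod.case scaleR_eq_mat_mult sum_mat_mult sum_f2_gt2 sum_ft2_g2 by simp
qed

lemma B3_eq_A3: "B3 (real J / 2 + 1) (Z, W) = A3 (real J / 2 + 1) (W, Z)"
proof -
  have idx: "real J / 2 + 1 - 1 = real J / 2" "real J / 2 + 1 - 1 / 2 = real J / 2 + 1 / 2" by simp_all
  have f: "ft3 (real J / 2 + 1) m n Z = inverse (det Z) *s ft1 (real J / 2) m n Z" for m n
    unfolding ft3_def ft1_def idx ..
  have g: "g3 (real J / 2 + 1) m n W = det W *s g1 (real J / 2) m n W" for m n
  proof -
    have "real J / 2 + 1 + m - 1/2 = real J / 2 + m + 1/2" "real J / 2 + 1 - m - 1/2 = real J / 2 - m + 1/2" by simp_all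
    then show ?thesis unfolding g3_def g1_def idx by (simp only:)
  qed
  have f': "f3 (real J / 2 + 1) m n W = det W *s f1 (real J / 2) m n W" for m n
    unfolding f3_def f1_def idx ..
  have g': "gt3 (real J / 2 + 1) m n Z = inverse (det Z) *s gt1 (real J / 2) m n Z" for m n
  proof -
    have "real J / 2 + 1 + m = real J / 2 + m + 1" "real J / 2 + 1 - m = real J / 2 - m + 1" by simp_all
    then show ?thesis unfolding gt3_def gt1_def idx by (simp only:)
  qed
  show ?thesis
    unfolding A3_def B3_def prod.case f g f' g' idx mult_scale_column_times_row scaleR_eq_mat_mult sum_mat_mult
      sum_f1_gt1 sum_ft1_g1 by (simp only: mult.commute)
qed

section \<open>Uniform convergence on compact sets\<close>

text \<open>
  Both eigenvalues of a matrix with trace \<open>\<tau>\<close> and determinant \<open>\<delta>\<close> lie in the open unit disk.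
\<close>

definition contractive :: "complex \<Rightarrow> complex \<Rightarrow> bool"
  where "contractive \<tau> \<delta> \<longleftrightarrow> (\<forall>x. x\<^sup>2 - \<tau> * x + \<delta> = 0 \<longrightarrow> norm x < 1)"

text \<open>
  For a left eigenvector \<open>y\<close> of \<open>A\<close> with eigenvalue \<open>\<alpha>\<close>, the Hermitian form of \<open>A A\<^sup>* - 1\<close> at the
  conjugate of \<open>y\<close> equals \<open>(|\<alpha>|\<^sup>2 - 1) |y|\<^sup>2\<close>.
\<close>

lemma Dplus_contractive:
  assumes "A \<in> Dplus"
  shows "contractive (trace A) (det A)"
  unfolding contractive_def
proof (intro allI impI)
  fix \<alpha> assume "\<alpha>\<^sup>2 - trace A * \<alpha> + det A = 0"
  then have "det (A - mat \<alpha>) = 0"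
    by (simp add: det_2 trace_def sum_2 mat_def power2_eq_square algebra_simps)
  then have "det (transpose (A - mat \<alpha>)) = 0" by (simp add: det_transpose)
  then have "\<not> (\<exists>B. B ** transpose (A - mat \<alpha>) = mat 1)"
    using invertible_det_nz[of "transpose (A - mat \<alpha>)"] unfolding invertible_left_inverse by blast
  then obtain y where y: "y \<noteq> 0" "transpose (A - mat \<alpha>) *v y = 0"
    unfolding matrix_left_invertible_ker by blast
  then have e: "A$1$k * y$1 + A$2$k * y$2 = \<alpha> * y$k" for k
    using exhaust_2[of k] by (auto simp: vec_eq_iff forall_2 matrix_vector_mult_def sum_2 transpose_def mat_def algebra_simps)
  define x :: "complex^2" where "x = (\<chi> i. cnj (y$i))"
  have "x \<noteq> 0" using y(1) by (auto simp: x_def vec_eq_iff)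
  have n: "z * cnj z = of_real ((norm z)\<^sup>2)" for z
    by (simp only: complex_norm_square)
  let ?H = "A ** adjoint_mat A - mat 1"
  have "(\<Sum>i\<in>UNIV. \<Sum>j\<in>UNIV. cnj (x$i) * ?H$i$j * x$j) =
     (A$1$1 * y$1 + A$2$1 * y$2) * cnj (A$1$1 * y$1 + A$2$1 * y$2) +
     (A$1$2 * y$1 + A$2$2 * y$2) * cnj (A$1$2 * y$1 + A$2$2 * y$2) - (y$1 * cnj (y$1) + y$2 * cnj (y$2))"
    by (simp add: sum_2 x_def matrix_matrix_mult_def adjoint_mat_def mat_def algebra_simps)
  also have "\<dots> = of_real (((norm \<alpha>)\<^sup>2 - 1) * ((norm (y$1))\<^sup>2 + (norm (y$2))\<^sup>2))"
    unfolding e n by (simp add: norm_mult power_mult_distrib algebra_simps)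
  finally have form: "(\<Sum>i\<in>UNIV. \<Sum>j\<in>UNIV. cnj (x$i) * ?H$i$j * x$j) = \<dots>" .
  have "Re (\<Sum>i\<in>UNIV. \<Sum>j\<in>UNIV. cnj (x$i) * ?H$i$j * x$j) < 0"
    using assms \<open>x \<noteq> 0\<close> unfolding Dplus_def negative_definite_def by blast
  then have neg: "((norm \<alpha>)\<^sup>2 - 1) * ((norm (y$1))\<^sup>2 + (norm (y$2))\<^sup>2) < 0"
    unfolding form Re_complex_of_real .
  have "(norm \<alpha>)\<^sup>2 < 1\<^sup>2"
  proof (rule ccontr)
    assume "\<not> (norm \<alpha>)\<^sup>2 < 1\<^sup>2"
    then have "0 \<le> ((norm \<alpha>)\<^sup>2 - 1) * ((norm (y$1))\<^sup>2 + (norm (y$2))\<^sup>2)"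
      by (intro mult_nonneg_nonneg) auto
    with neg show False by simp
  qed
  then show "norm \<alpha> < 1" by (rule power_less_imp_less_base) simp
qed

definition contractive_pairs :: "((complex^2^2) \<times> (complex^2^2)) set"
  where "contractive_pairs = {(Z, W). det W \<noteq> 0 \<and> contractive (rel_trace Z W) (rel_det Z W)}"

lemma region_contractive: "region \<subseteq> contractive_pairs"
proof -
  have "contractive (rel_trace Z W) (rel_det Z W)"
    if "det W \<noteq> 0" "Z ** matrix_inv W \<in> Dplus" for Z W
  proof -
    have "trace (Z ** matrix_inv W) = rel_trace Z W" unfolding rel_trace_def by (rule trace_mul_sym)
    moreover have "det (Z ** matrix_inv W) = rel_det Z W"
      by (simp only: rel_det_def det_mul det_matrix_inv[OF that(1)] divide_inverse)
    ultimately show ?thesis using Dplus_contractive[OF that(2)] by simp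
  qed
  then show ?thesis by (auto simp: region_def contractive_pairs_def invertible_det_nz)
qed

text \<open>
  After the exchange, \<open>region'\<close> is described by the matrix \<open>Z\<inverse> W\<close> itself, whose trace and determinant are exactly \<open>rel_trace W Z\<close>
  and \<open>rel_det W Z\<close>.
\<close>

lemma region'_contractive: "prod.swap ` region' \<subseteq> contractive_pairs"
proof -
  have "contractive (rel_trace W Z) (rel_det W Z)"
    if "det Z \<noteq> 0" "matrix_inv Z ** W \<in> Dplus" for Z W
  proof -
    have "det (matrix_inv Z ** W) = rel_det W Z"
      by (simp only: rel_det_def det_mul det_matrix_inv[OF that(1)] divide_inverse mult.commute)
    then show ?thesis using Dplus_contractive[OF that(2)] by (simp add: rel_trace_def)
  qed
  then show ?thesis by (auto simp: region'_def contractive_pairs_def invertible_det_nz)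
qed

lemma quadratic_roots:
  obtains \<alpha> \<beta> :: complex where "\<tau> = \<alpha> + \<beta>" "\<delta> = \<alpha> * \<beta>"
proof
  show "\<tau> = (\<tau> + csqrt (\<tau>\<^sup>2 - 4 * \<delta>)) / 2 + (\<tau> - csqrt (\<tau>\<^sup>2 - 4 * \<delta>)) / 2"
    by (simp add: field_simps)
  have "(\<tau> + csqrt (\<tau>\<^sup>2 - 4 * \<delta>)) * (\<tau> - csqrt (\<tau>\<^sup>2 - 4 * \<delta>)) = 4 * \<delta>"
    by (simp add: algebra_simps flip: power2_eq_square)
  then show "\<delta> = (\<tau> + csqrt (\<tau>\<^sup>2 - 4 * \<delta>)) / 2 * ((\<tau> - csqrt (\<tau>\<^sup>2 - 4 * \<delta>)) / 2)"
    by simp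
qed

text \<open>
  The generating series is the product of two geometric series.
\<close>

lemma sym_char_eq: "sym_char (\<alpha> + \<beta>) (\<alpha> * \<beta>) n = (\<Sum>i\<le>n. \<alpha> ^ i * \<beta> ^ (n - i))"
proof -
  have geo: "Abs_fps (\<lambda>n. x ^ n) * (1 - fps_const x * fps_X) = 1" for x :: complex
  proof (rule fps_ext)
    fix n
    have "Abs_fps (\<lambda>n. x ^ n) * (1 - fps_const x * fps_X) =
        Abs_fps (\<lambda>n. x ^ n) - fps_const x * (fps_X * Abs_fps (\<lambda>n. x ^ n))"
      by (simp only: right_diff_distrib mult_1_right mult_1_left mult_ac)
    then show "fps_nth (Abs_fps (\<lambda>n. x ^ n) * (1 - fps_const x * fps_X)) n = fps_nth 1 n"
      by (cases n) simp_all
  qed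
  have "char_poly_fps (\<alpha> + \<beta>) (\<alpha> * \<beta>) = (1 - fps_const \<alpha> * fps_X) * (1 - fps_const \<beta> * fps_X)"
    by (simp only: char_poly_fps_def power2_eq_square fps_const_add [symmetric] fps_const_mult [symmetric])
       (simp only: algebra_simps mult_1_left mult_1_right)
  then have "(Abs_fps (\<lambda>n. \<alpha> ^ n) * Abs_fps (\<lambda>n. \<beta> ^ n)) * char_poly_fps (\<alpha> + \<beta>) (\<alpha> * \<beta>) =
      (Abs_fps (\<lambda>n. \<alpha> ^ n) * (1 - fps_const \<alpha> * fps_X)) * (Abs_fps (\<lambda>n. \<beta> ^ n) * (1 - fps_const \<beta> * fps_X))"
    by (simp only: mult_ac)
  then have GP: "(Abs_fps (\<lambda>n. \<alpha> ^ n) * Abs_fps (\<lambda>n. \<beta> ^ n)) * char_poly_fps (\<alpha> + \<beta>) (\<alpha> * \<beta>) = 1"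
    unfolding geo by simp
  have "inverse (char_poly_fps (\<alpha> + \<beta>) (\<alpha> * \<beta>)) = Abs_fps (\<lambda>n. \<alpha> ^ n) * Abs_fps (\<lambda>n. \<beta> ^ n)"
    using fps_inverse_unique[OF GP[unfolded mult.commute[of _ "char_poly_fps _ _"]]] by simp
  then show ?thesis by (simp add: sym_char_def fps_mult_nth atLeast0AtMost)
qed

lemma norm_sym_char_le:
  assumes "norm \<alpha> \<le> r" "norm \<beta> \<le> r"
  shows "norm (sym_char (\<alpha> + \<beta>) (\<alpha> * \<beta>) n) \<le> real (Suc n) * r ^ n"
proof -
  have "norm (\<alpha> ^ i * \<beta> ^ (n - i)) \<le> r ^ n" if "i \<le> n" for i
  proof -
    have "norm (\<alpha> ^ i * \<beta> ^ (n - i)) \<le> r ^ i * r ^ (n - i)"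
      unfolding norm_mult norm_power using assms
      by (intro mult_mono power_mono) (auto intro: order.trans[OF norm_ge_zero] zero_le_power)
    then show ?thesis using that by (simp flip: power_add)
  qed
  then have "norm (sym_char (\<alpha> + \<beta>) (\<alpha> * \<beta>) n) \<le> (\<Sum>i\<le>n. r ^ n)"
    unfolding sym_char_eq by (intro sum_norm_le) auto
  then show ?thesis by simp
qed

lemma sym_char_deriv_Suc:
  "sym_char_deriv \<tau> \<delta> (Suc n) = (\<Sum>i\<le>n. sym_char \<tau> \<delta> i * sym_char \<tau> \<delta> (n - i))"
  by (simp add: sym_char_deriv_def sym_char_def power2_eq_square fps_mult_nth [of "inverse _"] atLeast0AtMost)

lemma norm_sym_char_deriv_Suc_le:
  assumes "norm \<alpha> \<le> r" "norm \<beta> \<le> r"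
  shows "norm (sym_char_deriv (\<alpha> + \<beta>) (\<alpha> * \<beta>) (Suc n)) \<le>
    (\<Sum>i\<le>n. (real (Suc i) * r ^ i) * (real (Suc (n - i)) * r ^ (n - i)))"
proof -
  have "0 \<le> r" using assms(1) norm_ge_zero order.trans by blast
  then show ?thesis
    unfolding sym_char_deriv_Suc
    by (intro sum_norm_le) (auto simp only: norm_mult intro!: mult_mono norm_sym_char_le assms mult_nonneg_nonneg
        zero_le_power norm_ge_zero)
qed

lemma summable_Suc_mult_geometric:
  assumes "0 \<le> r" "r < 1"
  shows "summable (\<lambda>n. real (Suc n) * r ^ n)"
proof -
  have "summable (\<lambda>n. norm (r ^ n))" using assms by (simp add: norm_power summable_geometric)
  from sums_summable[OF Cauchy_product_sums[OF this this]] show ?thesis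
    by (simp flip: power_add)
qed

lemma summable_convolution:
  assumes "0 \<le> r" "r < 1"
  shows "summable (\<lambda>n. \<Sum>i\<le>n. (real (Suc i) * r ^ i) * (real (Suc (n - i)) * r ^ (n - i)))"
proof -
  have "summable (\<lambda>n. norm (real (Suc n) * r ^ n))"
    using summable_Suc_mult_geometric[OF assms] assms by (simp add: abs_mult power_abs del: of_nat_Suc)
  from sums_summable[OF Cauchy_product_sums[OF this this]] show ?thesis .
qed

lemma rel_trace_eq:
  assumes "det W \<noteq> 0"
  shows "rel_trace Z W = (Z$1$1 * W$2$2 - Z$2$1 * W$1$2 - Z$1$2 * W$2$1 + Z$2$2 * W$1$1) / det W"
proof -
  have "rel_trace Z W = inverse (det W) * (Z$1$1 * W$2$2 - Z$2$1 * W$1$2 - Z$1$2 * W$2$1 + Z$2$2 * W$1$1)"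
    unfolding rel_trace_def matrix_inv_adjugate[OF assms]
    by (simp add: trace_def sum_2 matrix_matrix_mult_def mat_def adjugate_def algebra_simps)
  then show ?thesis by (simp only: divide_inverse mult.commute)
qed

lemma continuous_on_rel:
  assumes "K \<subseteq> contractive_pairs"
  shows "continuous_on K (\<lambda>p. inverse (det (snd p)))"
    "continuous_on K (\<lambda>p. rel_trace (fst p) (snd p))" "continuous_on K (\<lambda>p. rel_det (fst p) (snd p))"
proof -
  have nz: "det (snd p) \<noteq> 0" if "p \<in> K" for p
    using assms that by (auto simp: contractive_pairs_def)
  have d: "continuous_on K (\<lambda>p. det (snd p))" "continuous_on K (\<lambda>p. det (fst p))"
    unfolding det_2 by (intro continuous_intros)+
  show "continuous_on K (\<lambda>p. inverse (det (snd p)))" "continuous_on K (\<lambda>p. rel_det (fst p) (snd p))"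
    unfolding rel_det_def using nz by (auto intro!: continuous_intros d)
  have "continuous_on K (\<lambda>p. (fst p$1$1 * snd p$2$2 - fst p$2$1 * snd p$1$2 - fst p$1$2 * snd p$2$1 + fst p$2$2 * snd p$1$1) / det (snd p))"
    using nz by (auto intro!: continuous_intros d)
  then show "continuous_on K (\<lambda>p. rel_trace (fst p) (snd p))"
    by (rule continuous_on_eq) (simp add: rel_trace_eq nz)
qed

text \<open>
  The roots need not be continuous functions on \<open>K\<close>, but the pairs of a root in the closed unit disk and a
  point of \<open>K\<close> form a compact set, on which the modulus of the root attains its maximum.
\<close>

lemma uniform_spectral_radius:
  assumes "compact K" "K \<subseteq> contractive_pairs"
  obtains r where "0 \<le> r" "r < 1"
    "\<And>p x. p \<in> K \<Longrightarrow> x\<^sup>2 - rel_trace (fst p) (snd p) * x + rel_det (fst p) (snd p) = 0 \<Longrightarrow> norm x \<le> r"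
proof -
  define g where "g = (\<lambda>(x, p). x\<^sup>2 - rel_trace (fst p) (snd p) * x + rel_det (fst p) (snd p))"
  define E where "E = {z \<in> cball 0 1 \<times> K. g z = 0}"
  have small: "norm x < 1" if "p \<in> K" "g (x, p) = 0" for x p
    using assms(2) that by (auto simp: contractive_pairs_def contractive_def g_def)
  have "continuous_on (cball 0 1 \<times> K) g"
    unfolding g_def case_prod_unfold
    by (intro continuous_on_add continuous_on_diff continuous_on_mult continuous_on_power continuous_on_fst
        continuous_on_id continuous_on_compose2[OF continuous_on_rel(2)[OF assms(2)], of _ snd]
        continuous_on_compose2[OF continuous_on_rel(3)[OF assms(2)], of _ snd] continuous_on_snd) auto
  moreover have cpt: "compact (cball (0::complex) 1 \<times> K)" using assms(1) by (intro compact_Times) auto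
  ultimately have "closed E"
    unfolding E_def by (intro continuous_closed_preimage_constant compact_imp_closed)
  then have "compact ((cball 0 1 \<times> K) \<inter> E)" by (rule compact_Int_closed[OF cpt])
  moreover have "(cball 0 1 \<times> K) \<inter> E = E" by (auto simp: E_def)
  ultimately have "compact E" by simp
  show thesis
  proof (cases "E = {}")
    case True
    show thesis
    proof (rule that[of 0])
      fix p x assume p: "p \<in> K" "x\<^sup>2 - rel_trace (fst p) (snd p) * x + rel_det (fst p) (snd p) = 0"
      then have "(x, p) \<in> E" using small[of p x] by (auto simp: E_def g_def)
      with True show "norm x \<le> 0" by simp
    qed auto
  next
    case False
    have "continuous_on E (\<lambda>z. norm (fst z))" by (intro continuous_intros)
    with \<open>compact E\<close> False obtain z where z: "z \<in> E" "\<And>y. y \<in> E \<Longrightarrow> norm (fst y) \<le> norm (fst z)"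
      using continuous_attains_sup[of E "\<lambda>z. norm (fst z)"] by blast
    show thesis
    proof (rule that[of "norm (fst z)"])
      show "norm (fst z) < 1" using z(1) small[of "snd z" "fst z"] by (auto simp: E_def)
    next
      fix p x assume p: "p \<in> K" "x\<^sup>2 - rel_trace (fst p) (snd p) * x + rel_det (fst p) (snd p) = 0"
      then have "(x, p) \<in> E" using small[of p x] by (auto simp: E_def g_def)
      with z(2) show "norm x \<le> norm (fst z)" by fastforce
    qed auto
  qed
qed

lemma root_of_quadratic:
  "\<alpha>\<^sup>2 - (\<alpha> + \<beta>) * \<alpha> + \<alpha> * \<beta> = 0" "\<beta>\<^sup>2 - (\<alpha> + \<beta>) * \<beta> + \<alpha> * \<beta> = 0" for \<alpha> \<beta> :: complex
  by (simp_all add: power2_eq_square algebra_simps)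

text \<open>
  The majorant is the convolution of \<open>(n + 1) r^n\<close> with itself, shifted by one, and \<open>(n + 1) r^n\<close> in turn is the convolution of
  a geometric series with itself. Both are summable as Cauchy products.
\<close>

lemma char_coeff_majorant:
  assumes "compact K" "K \<subseteq> contractive_pairs"
  obtains b where "summable b" "\<And>n p. p \<in> K \<Longrightarrow> norm (char_coeff n (fst p) (snd p)) \<le> b n"
proof -
  obtain r where r: "0 \<le> r" "r < 1"
    "\<And>p x. p \<in> K \<Longrightarrow> x\<^sup>2 - rel_trace (fst p) (snd p) * x + rel_det (fst p) (snd p) = 0 \<Longrightarrow> norm x \<le> r"
    using uniform_spectral_radius[OF assms] by blast
  define b where "b = case_nat 0 (\<lambda>n. \<Sum>i\<le>n. (real (Suc i) * r ^ i) * (real (Suc (n - i)) * r ^ (n - i)))"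
  have "summable (\<lambda>n. b (Suc n))" unfolding b_def using summable_convolution[OF r(1,2)] by simp
  then have "summable b" by (simp only: summable_Suc_iff)
  moreover have "norm (char_coeff n (fst p) (snd p)) \<le> b n" if p: "p \<in> K" for n p
  proof (cases n)
    case 0
    then show ?thesis by (simp add: char_coeff_def b_def)
  next
    case (Suc k)
    obtain \<alpha> \<beta> where roots: "rel_trace (fst p) (snd p) = \<alpha> + \<beta>" "rel_det (fst p) (snd p) = \<alpha> * \<beta>"
      by (rule quadratic_roots)
    have "norm \<alpha> \<le> r" "norm \<beta> \<le> r"
      using r(3)[OF p, unfolded roots] root_of_quadratic by blast+
    from norm_sym_char_deriv_Suc_le[OF this] show ?thesis
      by (simp only: Suc char_coeff_def roots b_def nat.case)
  qed
  ultimately show thesis by (rule that)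
qed

lemma norm_mat_mult: "norm (mat c ** X) = norm c * norm X" for X :: "complex^2^2"
  by (simp add: norm_vec_def mat_mult_nth norm_mult L2_set_right_distrib [symmetric] L2_set_nonneg)

lemma continuous_on_mat_mult:
  fixes F :: "'p::topological_space \<Rightarrow> complex^2^2"
  assumes "continuous_on K f" "continuous_on K F"
  shows "continuous_on K (\<lambda>p. mat (f p) ** F p)"
proof -
  have "(\<lambda>p. mat (f p) ** F p) = (\<lambda>p. \<chi> i j. f p * F p $ i $ j)"
    by (auto simp: vec_eq_iff mat_mult_nth)
  then show ?thesis by (simp only:) (intro continuous_on_vec_lambda continuous_intros assms)
qed

text \<open>
  All three series have terms of this shape, with \<open>F\<close> and \<open>G\<close> bounded on \<open>K\<close> by continuity.
\<close>

lemma uniformly_convergent_char_series: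
  fixes F G :: "(complex^2^2) \<times> (complex^2^2) \<Rightarrow> complex^2^2"
  assumes K: "compact K" "K \<subseteq> contractive_pairs" and cont: "continuous_on K F" "continuous_on K G"
    and u: "\<And>k. norm (u k) \<le> 1"
    and f: "\<And>k p. p \<in> K \<Longrightarrow> f k p = mat (u k) ** (mat (char_coeff (Suc k) (fst p) (snd p)) ** F p -
      mat (char_coeff k (fst p) (snd p)) ** G p)"
  shows "uniformly_convergent_on K (\<lambda>L p. \<Sum>k<L. f k p)"
proof -
  obtain b where b: "summable b" "\<And>n p. p \<in> K \<Longrightarrow> norm (char_coeff n (fst p) (snd p)) \<le> b n"
    using char_coeff_majorant[OF K] by blast
  have "bounded (F ` K)" "bounded (G ` K)"
    using cont K(1) by (auto intro!: compact_imp_bounded compact_continuous_image)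
  then obtain C D where C: "\<And>p. p \<in> K \<Longrightarrow> norm (F p) \<le> C" and D: "\<And>p. p \<in> K \<Longrightarrow> norm (G p) \<le> D"
    unfolding bounded_iff by (metis image_eqI)
  have "summable (\<lambda>k. b (Suc k) * C + b k * D)"
    using b(1) by (intro summable_add summable_mult2) (simp_all only: summable_Suc_iff)
  moreover have "norm (f k p) \<le> b (Suc k) * C + b k * D" if p: "p \<in> K" for k p
  proof -
    let ?X = "mat (char_coeff (Suc k) (fst p) (snd p)) ** F p" and ?Y = "mat (char_coeff k (fst p) (snd p)) ** G p"
    have "norm (f k p) = norm (u k) * norm (?X - ?Y)"
      unfolding f[OF p] norm_mat_mult ..
    also have "\<dots> \<le> norm (?X - ?Y)" using mult_right_mono[OF u, of "norm (?X - ?Y)" k] by simp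
    also have "\<dots> \<le> norm ?X + norm ?Y" by (rule norm_triangle_ineq4)
    also have "\<dots> \<le> b (Suc k) * C + b k * D"
      unfolding norm_mat_mult using p
      by (intro add_mono mult_mono b(2) C D norm_ge_zero order.trans[OF norm_ge_zero b(2)])
    finally show ?thesis .
  qed
  ultimately show ?thesis by (intro Weierstrass_m_test') auto
qed

lemma norm_inverse_nat_le_1: "norm (1 / of_nat (Suc k) :: complex) \<le> 1"
  by (simp add: norm_divide del: of_nat_Suc)

lemma uniformly_convergent_A:
  assumes K: "compact K" "K \<subseteq> contractive_pairs"
  shows "uniformly_convergent_on K (half_series 0 A1)"
    "uniformly_convergent_on K (half_series (1/2) A2)"
    "uniformly_convergent_on K (half_series 1 A3)"
proof -
  have nz: "det (snd p) \<noteq> 0" if "p \<in> K" for p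
    using K(2) that by (auto simp: contractive_pairs_def)
  note cont = continuous_on_mat_mult continuous_on_rel[OF K(2)] continuous_on_fst continuous_on_snd
    continuous_on_mult continuous_on_id
  have i: "1/2 + real k / 2 = real (Suc k) / 2" "1 + real k / 2 = real k / 2 + 1" for k by (simp_all add: field_simps)
  show "uniformly_convergent_on K (half_series 0 A1)"
    unfolding half_series_def add_0
  proof (rule uniformly_convergent_char_series[OF K])
    show "A1 (real k / 2) p = mat (1 / of_nat (Suc k)) **
      (mat (char_coeff (Suc k) (fst p) (snd p)) ** (mat (inverse (det (snd p))) ** snd p) -
       mat (char_coeff k (fst p) (snd p)) ** (mat (inverse (det (snd p))) ** fst p))" if "p \<in> K" for k p
      using A1_closed[OF nz[OF that], of k "fst p"] by (simp only: inverse_eq_divide prod.collapse)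
  qed (intro cont norm_inverse_nat_le_1)+
  show "uniformly_convergent_on K (half_series (1/2) A2)"
    unfolding half_series_def i
  proof (rule uniformly_convergent_char_series[OF K])
    show "A2 (real (Suc k) / 2) p = mat (1 / (of_nat (Suc k) * of_nat (Suc (Suc k)))) **
      (mat (char_coeff (Suc k) (fst p) (snd p)) ** (mat (inverse (det (snd p))) ** fst p) -
       mat (char_coeff k (fst p) (snd p)) ** (mat (rel_det (fst p) (snd p) * inverse (det (snd p))) ** snd p))"
      if "p \<in> K" for k p
      using A2_closed[OF nz[OF that], of k "fst p"] by (simp only: divide_inverse prod.collapse mult_1_left)
    show "norm (1 / (of_nat (Suc k) * of_nat (Suc (Suc k))) :: complex) \<le> 1" for k
      using norm_inverse_nat_le_1[of "k + Suc k * Suc k"] by (simp only: of_nat_mult [symmetric]) (simp add: algebra_simps)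
  qed (intro cont norm_inverse_nat_le_1)+
  show "uniformly_convergent_on K (half_series 1 A3)"
    unfolding half_series_def i
  proof (rule uniformly_convergent_char_series[OF K])
    show "A3 (real k / 2 + 1) p = mat (1 / of_nat (Suc (Suc k))) **
      (mat (char_coeff (Suc k) (fst p) (snd p)) ** (mat (rel_det (fst p) (snd p) * inverse (det (snd p))) ** snd p) -
       mat (char_coeff k (fst p) (snd p)) ** (mat (rel_det (fst p) (snd p) * inverse (det (snd p))) ** fst p))"
      if "p \<in> K" for k p
      using A3_closed[OF nz[OF that], of k "fst p"] by (simp only: divide_inverse prod.collapse mult_1_left)
  qed (intro cont norm_inverse_nat_le_1)+
qed


section \<open>The value of the sum\<close>

lemma sym_char_sums:
  assumes "contractive \<tau> \<delta>"
  shows "sym_char \<tau> \<delta> sums inverse (1 - \<tau> + \<delta>)"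
proof -
  obtain \<alpha> \<beta> where roots: "\<tau> = \<alpha> + \<beta>" "\<delta> = \<alpha> * \<beta>" by (rule quadratic_roots)
  have *: "norm \<alpha> < 1" "norm \<beta> < 1"
    using assms root_of_quadratic unfolding contractive_def roots by blast+
  have "summable (\<lambda>k. norm (\<alpha> ^ k))" "summable (\<lambda>k. norm (\<beta> ^ k))"
    using * by (simp_all add: norm_power summable_geometric)
  from Cauchy_product_sums[OF this] * have "sym_char \<tau> \<delta> sums (1 / (1 - \<alpha>) * (1 / (1 - \<beta>)))"
    by (simp add: suminf_geometric roots flip: sym_char_eq)
  moreover have "1 / (1 - \<alpha>) * (1 / (1 - \<beta>)) = inverse (1 - \<tau> + \<delta>)"
    by (simp add: roots divide_inverse algebra_simps flip: inverse_mult_distrib)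
  ultimately show ?thesis by simp
qed

text \<open>
  The \<open>k\<close>-th entry of \<open>- A1 + A2 + A3\<close>, for corresponding entries \<open>z\<close> of \<open>Z / N(W)\<close> and \<open>w\<close> of \<open>W / N(W)\<close>. The recurrence
  \<open>a (k + 1) - \<delta> a (k - 1) = (k + 1) \<chi> k\<close> eliminates \<open>\<chi> k\<close>, and \<open>1 / ((k + 1) (k + 2))\<close> splits into partial
  fractions. What is left are differences of \<open>u\<close> and of \<open>e\<close>. In \<open>e 0\<close> the truncated index \<open>0 - 1 = 0\<close> gives the
  right value, as \<open>a 0 = 0\<close>.
\<close>

lemma kernel_term_telescopes:
  fixes \<tau> \<delta> z w :: complex
  defines "a \<equiv> sym_char_deriv \<tau> \<delta>"
  defines "u \<equiv> \<lambda>n. a n / of_nat (Suc n)" and "e \<equiv> \<lambda>n. a (n - 1) / of_nat (Suc n)"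
  shows "- (1 / of_nat (Suc k) * (a (Suc k) * w - a k * z)) +
      1 / (of_nat (Suc k) * of_nat (Suc (Suc k))) * (a (Suc k) * z - a k * (\<delta> * w)) +
      1 / of_nat (Suc (Suc k)) * (a (Suc k) * (\<delta> * w) - a k * (\<delta> * z)) =
    sym_char \<tau> \<delta> k * (z - w) + (u (Suc k) - u k) * (\<delta> * w - z) + (e (Suc k) - e k) * (\<delta> * (w - z))"
proof -
  define x y :: complex where "x = of_nat (Suc k)" and "y = of_nat (Suc (Suc k))"
  have nz: "x \<noteq> 0" "y \<noteq> 0" unfolding x_def y_def by (simp_all only: of_nat_eq_0_iff)
  have y: "y = x + 1" by (simp add: x_def y_def)
  have "a (Suc k) = x * sym_char \<tau> \<delta> k + \<delta> * a (k - 1)"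
  proof (cases k)
    case (Suc j)
    then show ?thesis using sym_char_deriv_diff[of \<tau> \<delta> j] by (simp add: a_def x_def algebra_simps)
  qed (simp add: a_def x_def)
  then have h: "sym_char \<tau> \<delta> k = a (Suc k) / x - \<delta> * e k"
    using nz unfolding e_def x_def [symmetric] by (simp add: field_simps)
  have xy: "1 / (x * y) = 1 / x - 1 / y" using nz by (simp add: y field_simps)
  show ?thesis
    unfolding h e_def u_def x_def [symmetric] y_def [symmetric] xy
    by (simp add: algebra_simps add_divide_distrib diff_divide_distrib)
qed

lemma det_diff_rel:
  assumes "det W \<noteq> 0"
  shows "det (Z - W) = det W * (1 - rel_trace Z W + rel_det Z W)"
proof -
  have "rel_trace Z W * det W = Z$1$1 * W$2$2 - Z$2$1 * W$1$2 - Z$1$2 * W$2$1 + Z$2$2 * W$1$1"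
    "rel_det Z W * det W = det Z"
    using assms by (simp_all add: rel_trace_eq rel_det_def)
  then have "det W * (1 - rel_trace Z W + rel_det Z W) =
      det W - (Z$1$1 * W$2$2 - Z$2$1 * W$1$2 - Z$1$2 * W$2$1 + Z$2$2 * W$1$1) + det Z"
    by (simp add: algebra_simps)
  then show ?thesis by (simp add: det_2 algebra_simps)
qed

lemma tendsto_divide_Suc:
  fixes f :: "nat \<Rightarrow> complex"
  assumes "f \<longlonglongrightarrow> 0"
  shows "(\<lambda>n. f n / of_nat (Suc n)) \<longlonglongrightarrow> 0"
  by (rule Lim_null_comparison[OF _ tendsto_norm_zero[OF assms]])
     (auto intro!: always_eventually simp: norm_divide divide_le_eq mult_le_cancel_left1 mult_left_le simp del: of_nat_Suc)

lemma kernel_expansion: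
  assumes "(Z, W) \<in> contractive_pairs"
  shows "det (Z - W) \<noteq> 0"
    and "repr_kernel (Z, W) = - half_suminf 0 A1 (Z, W) + half_suminf (1/2) A2 (Z, W) + half_suminf 1 A3 (Z, W)"
proof -
  have nz: "det W \<noteq> 0" and contr: "contractive (rel_trace Z W) (rel_det Z W)"
    using assms by (auto simp: contractive_pairs_def)
  let ?P = "1 - rel_trace Z W + rel_det Z W"
  have "?P \<noteq> 0"
    using contr by (auto simp: contractive_def dest: spec[of _ 1])
  with nz show det: "det (Z - W) \<noteq> 0" by (simp add: det_diff_rel)
  define a where "a = (\<lambda>n. char_coeff n Z W)"
  define u where "u = (\<lambda>n. a n / of_nat (Suc n))"
  define e where "e = (\<lambda>n. a (n - 1) / of_nat (Suc n))"
  define T where "T = (\<lambda>k. - A1 (0 + real k / 2) (Z, W) + A2 (1/2 + real k / 2) (Z, W) + A3 (1 + real k / 2) (Z, W))"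
  let ?S = "- half_suminf 0 A1 (Z, W) + half_suminf (1/2) A2 (Z, W) + half_suminf 1 A3 (Z, W)"
  have K: "compact {(Z, W)}" "{(Z, W)} \<subseteq> contractive_pairs" using assms by auto
  have "summable (\<lambda>k. A (c + real k / 2) (Z, W))" if "uniformly_convergent_on {(Z, W)} (half_series c A)" for A c
    using uniformly_convergent_imp_convergent[OF that, of "(Z, W)"]
    by (simp add: half_series_def summable_iff_convergent)
  note summable_A = this[OF uniformly_convergent_A(1)[OF K]] this[OF uniformly_convergent_A(2)[OF K]]
    this[OF uniformly_convergent_A(3)[OF K]]
  have "T sums ?S"
    unfolding T_def half_suminf_def
    by (intro sums_add sums_minus summable_sums summable_A)
  obtain b where b: "summable b" "\<And>n. norm (a n) \<le> b n"
    using char_coeff_majorant[OF K] unfolding a_def by (metis fst_conv insertI1 snd_conv)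
  have a0: "a \<longlonglongrightarrow> 0"
    by (rule Lim_null_comparison[OF _ summable_LIMSEQ_zero[OF b(1)]]) (simp add: b(2))
  have "(\<lambda>n. a (n - 1)) \<longlonglongrightarrow> 0"
    using a0 by (subst filterlim_sequentially_Suc [symmetric]) simp
  then have e_lim: "e \<longlonglongrightarrow> 0" unfolding e_def by (rule tendsto_divide_Suc)
  have u_lim: "u \<longlonglongrightarrow> 0" unfolding u_def using a0 by (rule tendsto_divide_Suc)
  have tele: "(\<lambda>n. u (Suc n) - u n) sums 0" "(\<lambda>n. e (Suc n) - e n) sums 0"
    using telescope_sums[OF u_lim] telescope_sums[OF e_lim]
    by (simp_all add: u_def e_def a_def char_coeff_def)
  have "T k $ i $ j = inverse (det W) * (sym_char (rel_trace Z W) (rel_det Z W) k * (Z$i$j - W$i$j) +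
      (u (Suc k) - u k) * (rel_det Z W * W$i$j - Z$i$j) +
      (e (Suc k) - e k) * (rel_det Z W * (W$i$j - Z$i$j)))" for k i j
  proof -
    have i: "1/2 + real k / 2 = real (Suc k) / 2" "1 + real k / 2 = real k / 2 + 1" by (simp_all add: field_simps)
    let ?d = "inverse (det W)"
    have "T k $ i $ j =
      - (1 / of_nat (Suc k) * (a (Suc k) * (?d * W$i$j) - a k * (?d * Z$i$j))) +
      1 / (of_nat (Suc k) * of_nat (Suc (Suc k))) * (a (Suc k) * (?d * Z$i$j) - a k * (rel_det Z W * (?d * W$i$j))) +
      1 / of_nat (Suc (Suc k)) * (a (Suc k) * (rel_det Z W * (?d * W$i$j)) - a k * (rel_det Z W * (?d * Z$i$j)))"
      unfolding T_def i add_0 A1_closed[OF nz] A2_closed[OF nz] A3_closed[OF nz] a_def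
      by (simp only: vector_add_component vector_uminus_component vector_minus_component mat_mult_nth
          divide_inverse mult_1_left mult.assoc)
    also have "\<dots> = sym_char (rel_trace Z W) (rel_det Z W) k * (?d * Z$i$j - ?d * W$i$j) +
      (u (Suc k) - u k) * (rel_det Z W * (?d * W$i$j) - ?d * Z$i$j) +
      (e (Suc k) - e k) * (rel_det Z W * (?d * W$i$j - ?d * Z$i$j))"
      unfolding u_def e_def a_def char_coeff_def by (rule kernel_term_telescopes)
    finally show ?thesis by (simp add: algebra_simps)
  qed
  moreover have "(\<lambda>k. inverse (det W) * (sym_char (rel_trace Z W) (rel_det Z W) k * (Z$i$j - W$i$j) +
      (u (Suc k) - u k) * (rel_det Z W * W$i$j - Z$i$j) +
      (e (Suc k) - e k) * (rel_det Z W * (W$i$j - Z$i$j)))) sums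
    (inverse (det W) * (inverse ?P * (Z$i$j - W$i$j) + 0 * (rel_det Z W * W$i$j - Z$i$j) +
      0 * (rel_det Z W * (W$i$j - Z$i$j))))" for i j
    by (intro sums_add sums_mult sums_mult2 sym_char_sums contr tele)
  ultimately have "(\<lambda>k. T k $ i $ j) sums ((Z$i$j - W$i$j) / det (Z - W))" for i j
    by (simp add: det_diff_rel[OF nz] divide_inverse mult_ac)
  moreover have "(\<lambda>k. T k $ i $ j) sums (?S $ i $ j)" for i j
    by (intro bounded_linear.sums[OF bounded_linear_vec_nth] \<open>T sums ?S\<close>)
  ultimately have "?S $ i $ j = (Z$i$j - W$i$j) / det (Z - W)" for i j
    by (metis sums_unique2)
  then show "repr_kernel (Z, W) = ?S"
    by (simp only: vec_eq_iff repr_kernel_def prod.case vec_lambda_beta vector_minus_component) simp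
qed

lemma half_series_B:
  "half_series 0 B1 L p = half_series 0 A1 L (prod.swap p)"
  "half_series (1/2) B2 L p = half_series (1/2) A2 L (prod.swap p)"
  "half_series 1 B3 L p = half_series 1 A3 L (prod.swap p)"
  and half_suminf_B:
  "half_suminf 0 B1 p = half_suminf 0 A1 (prod.swap p)"
  "half_suminf (1/2) B2 p = half_suminf (1/2) A2 (prod.swap p)"
  "half_suminf 1 B3 p = half_suminf 1 A3 (prod.swap p)"
proof -
  obtain Z W where p: "p = (Z, W)" by (cases p)
  have i: "1/2 + real k / 2 = real (Suc k) / 2" "1 + real k / 2 = real k / 2 + 1" for k by (simp_all add: field_simps)
  show "half_series 0 B1 L p = half_series 0 A1 L (prod.swap p)"
    "half_series (1/2) B2 L p = half_series (1/2) A2 L (prod.swap p)"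
    "half_series 1 B3 L p = half_series 1 A3 L (prod.swap p)"
    "half_suminf 0 B1 p = half_suminf 0 A1 (prod.swap p)"
    "half_suminf (1/2) B2 p = half_suminf (1/2) A2 (prod.swap p)"
    "half_suminf 1 B3 p = half_suminf 1 A3 (prod.swap p)"
    unfolding half_series_def half_suminf_def i add_0 p swap_simp B1_eq_A1 B2_eq_A2 B3_eq_A3 by (rule refl)+
qed

text \<open>
  The exchange of \<open>Z\<close> and \<open>W\<close> maps compact subsets of \<open>region'\<close> to compact subsets of \<open>contractive_pairs\<close>,
  so uniform convergence carries over.
\<close>

lemma unif_conv_on_compacts_swap:
  assumes A: "\<And>K. compact K \<Longrightarrow> K \<subseteq> contractive_pairs \<Longrightarrow> uniformly_convergent_on K S"
    and S': "\<And>L p. p \<in> region' \<Longrightarrow> S' L p = S L (prod.swap p)"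
  shows "unif_conv_on_compacts region' S'"
  unfolding unif_conv_on_compacts_def
proof (intro allI impI)
  fix K assume K: "compact K" "K \<subseteq> region'"
  have "compact (prod.swap ` K)"
    using K(1) by (intro compact_continuous_image continuous_on_swap)
  moreover have "prod.swap ` K \<subseteq> contractive_pairs"
    using K(2) region'_contractive by blast
  ultimately obtain l where "uniform_limit (prod.swap ` K) S l sequentially"
    using A unfolding uniformly_convergent_on_def by blast
  then have "uniform_limit K (\<lambda>n p. S n (prod.swap p)) (\<lambda>p. l (prod.swap p)) sequentially"
    by (rule uniform_limit_compose') auto
  then have "uniform_limit K S' (\<lambda>p. l (prod.swap p)) sequentially"
    by (rule uniform_limit_cong'[THEN iffD1, rotated -1]) (use S' K(2) in auto)
  then show "uniformly_convergent_on K S'" unfolding uniformly_convergent_on_def by blast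
qed

theorem theorem51:
  shows "unif_conv_on_compacts region (half_series 0 A1)
    \<and> unif_conv_on_compacts region (half_series (1/2) A2)
    \<and> unif_conv_on_compacts region (half_series 1 A3)
    \<and> (\<forall>p\<in>region. det (fst p - snd p) \<noteq> 0 \<and>
          repr_kernel p = - half_suminf 0 A1 p + half_suminf (1/2) A2 p + half_suminf 1 A3 p)
    \<and> unif_conv_on_compacts region' (half_series 0 B1)
    \<and> unif_conv_on_compacts region' (half_series (1/2) B2)
    \<and> unif_conv_on_compacts region' (half_series 1 B3)
    \<and> (\<forall>p\<in>region'. det (fst p - snd p) \<noteq> 0 \<and>
          repr_kernel p = half_suminf 0 B1 p - half_suminf (1/2) B2 p - half_suminf 1 B3 p)"
proof (intro conjI ballI)
  show "unif_conv_on_compacts region (half_series 0 A1)"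
    "unif_conv_on_compacts region (half_series (1/2) A2)"
    "unif_conv_on_compacts region (half_series 1 A3)"
    unfolding unif_conv_on_compacts_def using uniformly_convergent_A region_contractive by blast+
next
  fix p assume "p \<in> region"
  then have p: "(fst p, snd p) \<in> contractive_pairs" using region_contractive by auto
  from kernel_expansion[OF p] show "det (fst p - snd p) \<noteq> 0"
    "repr_kernel p = - half_suminf 0 A1 p + half_suminf (1/2) A2 p + half_suminf 1 A3 p"
    by simp_all
next
  show "unif_conv_on_compacts region' (half_series 0 B1)"
    by (rule unif_conv_on_compacts_swap[OF uniformly_convergent_A(1)]) (auto simp: half_series_B)
  show "unif_conv_on_compacts region' (half_series (1/2) B2)"
    by (rule unif_conv_on_compacts_swap[OF uniformly_convergent_A(2)]) (auto simp: half_series_B)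
  show "unif_conv_on_compacts region' (half_series 1 B3)"
    by (rule unif_conv_on_compacts_swap[OF uniformly_convergent_A(3)]) (auto simp: half_series_B)
  fix p assume p: "p \<in> region'"
  obtain Z W where ZW: "p = (Z, W)" by (cases p)
  have WZ: "(W, Z) \<in> contractive_pairs" using p region'_contractive by (auto simp: ZW)
  have d: "det (Z - W) = det (W - Z)" by (simp add: det_2 algebra_simps)
  show "det (fst p - snd p) \<noteq> 0" using kernel_expansion(1)[OF WZ] by (simp add: ZW d)
  have "repr_kernel p = - repr_kernel (W, Z)"
    by (simp add: ZW repr_kernel_def d vec_eq_iff diff_divide_distrib)
  then show "repr_kernel p = half_suminf 0 B1 p - half_suminf (1/2) B2 p - half_suminf 1 B3 p"
    by (simp add: kernel_expansion(2)[OF WZ] half_suminf_B ZW)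
qed

end
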